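(* Let $A$ and $B$ be $C^*$-algebras. For closed modular ideals $I$ and $J$ of $A$ and $B$, respectively, $I\widehat\otimes J$ is modular in $A\widehat\otimes B$ if and only if both $A$ and $B$ are unital.
   Context: Ideals are two-sided. For operator spaces $E,F$ (closed subspaces of some $B(H)$, $H$ a Hilbert space), the operator space projective tensor product $E\widehat\otimes F$ is the completion of the algebraic tensor product $E\otimes F$ in the norm $\|u\|_\wedge=\inf\{\|\alpha\|\|v\|\|w\|\|\beta\| : u=\alpha(v\otimes w)\beta\}$, where the infimum is over all decompositions with $v\in M_p(E)$, $w\in M_q(F)$, $\alpha\in M_{1,pq}$, $\beta\in M_{pq,1}$, $p,q\in\mathbb N$ arbitrary ($M_{k,l}$ is the space of $k\times l$ complex matrices, and $v\otimes w\in M_{pq}(E\otimes F)$ is the Kronecker-type tensor product). For $C^*$-algebras $A,B$, $A\widehat\otimes B$ is a Banach $*$-algebra with $(a\otimes b)(c\otimes d)=ac\otimes bd$ and isometric involution $(a\otimes b)^*=a^*\otimes b^*$. For closed ideals $I\subseteq A$, $J\subseteq B$, $I\widehat\otimes J$ is identified with a closed ideal of $A\widehat\otimes B$, namely the closure of $I\otimes J$ in $A\widehat\otimes B$ (known fact). An ideal $I$ of a Banach algebra $A$ is modular if there exists $e\in A$ such that $xe-x\in I$ and $ex-x\in I$ for all $x\in A$ (equivalently, $A/I$ is unital).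
   Formalization: The closed modular ideals I and J are assumed proper (I ≠ A, J ≠ B); without this the claim fails, e.g. for I = A and J = B with A, B nonunital, where I ⊗̂ J is all of A ⊗̂ B and hence modular. *)

theory Defs
  imports "HOL-Analysis.Analysis" "HOL-Library.Multiset"
begin

section \<open>Complex Banach algebras, C*-algebras and Hilbert spaces\<close>

class scaleC =
  fixes scaleC :: "complex \<Rightarrow> 'a \<Rightarrow> 'a"  (infixr "*\<^sub>C" 75)

class complex_vector = scaleC + real_vector +
  assumes scaleC_add_right: "c *\<^sub>C (x + y) = c *\<^sub>C x + c *\<^sub>C y"
    and scaleC_add_left: "(c + d) *\<^sub>C x = c *\<^sub>C x + d *\<^sub>C x"
    and scaleC_scaleC: "c *\<^sub>C d *\<^sub>C x = (c * d) *\<^sub>C x"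
    and scaleC_one: "1 *\<^sub>C x = x"
    and scaleR_scaleC: "r *\<^sub>R x = complex_of_real r *\<^sub>C x"

global_interpretation complex_vector: vector_space "scaleC :: complex \<Rightarrow> 'a \<Rightarrow> 'a::complex_vector"
  by unfold_locales (fact scaleC_add_right scaleC_add_left scaleC_scaleC scaleC_one)+

abbreviation clinear :: "('a::complex_vector \<Rightarrow> 'b::complex_vector) \<Rightarrow> bool"
  where "clinear \<equiv> Vector_Spaces.linear scaleC scaleC"

class complex_normed_vector = complex_vector + real_normed_vector +
  assumes norm_scaleC: "norm (c *\<^sub>C x) = cmod c * norm x"

text \<open>Algebras are not assumed to have a unit.\<close>

class complex_banach_algebra = complex_normed_vector + real_normed_algebra + banach +
  assumes mult_scaleC_left: "(c *\<^sub>C x) * y = c *\<^sub>C (x * y)"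
    and mult_scaleC_right: "x * (c *\<^sub>C y) = c *\<^sub>C (x * y)"

class cstar_algebra = complex_banach_algebra +
  fixes star :: "'a \<Rightarrow> 'a"
  assumes star_add: "star (x + y) = star x + star y"
    and star_scaleC: "star (c *\<^sub>C x) = cnj c *\<^sub>C star x"
    and star_mult: "star (x * y) = star y * star x"
    and star_star: "star (star x) = x"
    and cstar_identity: "norm (star x * x) = (norm x)\<^sup>2"

text \<open>The inner product is linear in its second argument.\<close>

class chilbert_space = complex_normed_vector + banach +
  fixes cinner :: "'a \<Rightarrow> 'a \<Rightarrow> complex"
  assumes cinner_commute: "cinner x y = cnj (cinner y x)"
    and cinner_add_right: "cinner x (y + z) = cinner x y + cinner x z"
    and cinner_scaleC_right: "cinner x (c *\<^sub>C y) = c * cinner x y"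
    and cinner_self: "cinner x x = complex_of_real ((norm x)\<^sup>2)"

section \<open>Ideals and modularity\<close>

definition is_unital :: "'a::complex_banach_algebra itself \<Rightarrow> bool" where
  "is_unital _ \<longleftrightarrow> (\<exists>e::'a. \<forall>x. e * x = x \<and> x * e = x)"

definition two_sided_ideal :: "'a::complex_banach_algebra set \<Rightarrow> bool" where
  "two_sided_ideal I \<longleftrightarrow>
     complex_vector.subspace I \<and> (\<forall>x\<in>I. \<forall>a. a * x \<in> I \<and> x * a \<in> I)"

definition modular_ideal :: "'a::complex_banach_algebra set \<Rightarrow> bool" where
  "modular_ideal I \<longleftrightarrow>
     two_sided_ideal I \<and> (\<exists>e. \<forall>x. x * e - x \<in> I \<and> e * x - x \<in> I)"

section \<open>The algebraic tensor product\<close>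

text \<open>A multiset of pairs stands for the formal sum of the corresponding elementary tensors, so
  the tensor product over the complex numbers is the free commutative monoid on the pairs modulo
  the congruence generated by bilinearity.  The clause \<open>zero\<close> is what turns the quotient monoid
  into a group.\<close>

inductive tensor_eq ::
  "('a::complex_vector \<times> 'b::complex_vector) multiset \<Rightarrow> ('a \<times> 'b) multiset \<Rightarrow> bool"
where
  refl: "tensor_eq M M"
| sym: "tensor_eq M N \<Longrightarrow> tensor_eq N M"
| trans: "tensor_eq M N \<Longrightarrow> tensor_eq N K \<Longrightarrow> tensor_eq M K"
| cong: "tensor_eq M N \<Longrightarrow> tensor_eq (M + K) (N + K)"
| add_left: "tensor_eq {#(a + a', b)#} {#(a, b), (a', b)#}"
| add_right: "tensor_eq {#(a, b + b')#} {#(a, b), (a, b')#}"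
| scale: "tensor_eq {#(c *\<^sub>C a, b)#} {#(a, c *\<^sub>C b)#}"
| zero: "tensor_eq {#(0, b)#} {#}"

quotient_type (overloaded) ('a, 'b) tensor =
  "('a::complex_vector \<times> 'b::complex_vector) multiset" / tensor_eq
  by (rule equivpI) (auto intro!: reflpI sympI transpI intro: tensor_eq.intros)

lift_definition elem_tensor ::
  "'a::complex_vector \<Rightarrow> 'b::complex_vector \<Rightarrow> ('a, 'b) tensor"  (infix "\<otimes>\<^sub>t" 75)
  is "\<lambda>a b. {#(a, b)#}" .

lemma tensor_eq_plus:
  assumes "tensor_eq M N" "tensor_eq M' N'"
  shows "tensor_eq (M + M') (N + N')"
  using tensor_eq.cong[OF assms(1), of M'] tensor_eq.cong[OF assms(2), of N]
  by (metis add.commute tensor_eq.trans)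

lemma tensor_eq_scale:
  assumes "tensor_eq M N"
  shows "tensor_eq (image_mset (map_prod (scaleC c) id) M) (image_mset (map_prod (scaleC c) id) N)"
  using assms
proof induction
  case (scale d a b)
  have "tensor_eq {#(d *\<^sub>C c *\<^sub>C a, b)#} {#(c *\<^sub>C a, d *\<^sub>C b)#}"
    by (rule tensor_eq.scale)
  then show ?case
    by (simp add: scaleC_scaleC mult.commute)
qed (auto simp: scaleC_add_right intro: tensor_eq.intros tensor_eq_plus)

lemma tensor_eq_scale_add:
  "tensor_eq (image_mset (map_prod (scaleC (c + d)) id) M)
     (image_mset (map_prod (scaleC c) id) M + image_mset (map_prod (scaleC d) id) M)"
proof (induction M)
  case empty
  then show ?case by (simp add: tensor_eq.refl)
next
  case (add x M)
  obtain a b where x: "x = (a, b)" by fastforce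
  from tensor_eq_plus[OF tensor_eq.add_left[of "c *\<^sub>C a" "d *\<^sub>C a" b] add]
  show ?case by (simp add: x scaleC_add_left add_mset_commute)
qed

lemma tensor_eq_zero: "tensor_eq (image_mset (map_prod (scaleC 0) id) M) {#}"
proof (induction M)
  case empty
  then show ?case by (simp add: tensor_eq.refl)
next
  case (add x M)
  from tensor_eq_plus[OF tensor_eq.zero[of "snd x"] add]
  show ?case by (cases x) simp
qed

instantiation tensor :: (complex_vector, complex_vector) complex_vector
begin

lift_definition zero_tensor :: "('a, 'b) tensor" is "{#}" .

lift_definition plus_tensor :: "('a, 'b) tensor \<Rightarrow> ('a, 'b) tensor \<Rightarrow> ('a, 'b) tensor" is "(+)"
  by (rule tensor_eq_plus)

lift_definition scaleC_tensor :: "complex \<Rightarrow> ('a, 'b) tensor \<Rightarrow> ('a, 'b) tensor"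
  is "\<lambda>c. image_mset (map_prod (scaleC c) id)"
  by (rule tensor_eq_scale)

definition scaleR_tensor :: "real \<Rightarrow> ('a, 'b) tensor \<Rightarrow> ('a, 'b) tensor"
  where "scaleR_tensor r u = complex_of_real r *\<^sub>C u"

definition uminus_tensor :: "('a, 'b) tensor \<Rightarrow> ('a, 'b) tensor"
  where "uminus_tensor u = (- 1) *\<^sub>C u"

definition minus_tensor :: "('a, 'b) tensor \<Rightarrow> ('a, 'b) tensor \<Rightarrow> ('a, 'b) tensor"
  where "minus_tensor u v = u + (- v)"

instance
proof
  fix u v w :: "('a, 'b) tensor" and c d :: complex and r s :: real
  show add_assoc: "u + v + w = u + (v + w)"
    by transfer (simp add: add_ac tensor_eq.refl)
  show "u + v = v + u"
    by transfer (simp add: add_ac tensor_eq.refl)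
  show "0 + u = u"
    by transfer (simp add: tensor_eq.refl)
  have add: "(c + d) *\<^sub>C u = c *\<^sub>C u + d *\<^sub>C u" for c d and u :: "('a, 'b) tensor"
    by transfer (rule tensor_eq_scale_add)
  have zero: "0 *\<^sub>C u = 0" for u :: "('a, 'b) tensor"
    by transfer (rule tensor_eq_zero)
  have one: "1 *\<^sub>C u = u" for u :: "('a, 'b) tensor"
    by transfer (simp add: scaleC_one map_prod_def id_def case_prod_beta' tensor_eq.refl)
  have right: "c *\<^sub>C (u + v) = c *\<^sub>C u + c *\<^sub>C v" for c and u v :: "('a, 'b) tensor"
    by transfer (simp add: tensor_eq.refl)
  have assoc: "c *\<^sub>C d *\<^sub>C u = (c * d) *\<^sub>C u" for c d and u :: "('a, 'b) tensor"
    by transfer (simp add: multiset.map_comp o_def map_prod_def id_def case_prod_beta'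
        scaleC_scaleC tensor_eq.refl)
  show "- u + u = 0"
    using add[of "- 1" 1 u] by (simp add: uminus_tensor_def zero one)
  show "u - v = u + - v"
    by (rule minus_tensor_def)
  show "r *\<^sub>R (u + v) = r *\<^sub>R u + r *\<^sub>R v" "(r + s) *\<^sub>R u = r *\<^sub>R u + s *\<^sub>R u"
    "r *\<^sub>R s *\<^sub>R u = (r * s) *\<^sub>R u" "1 *\<^sub>R u = u" "r *\<^sub>R u = complex_of_real r *\<^sub>C u"
    by (simp_all add: scaleR_tensor_def right add assoc one)
  show "c *\<^sub>C (u + v) = c *\<^sub>C u + c *\<^sub>C v" "(c + d) *\<^sub>C u = c *\<^sub>C u + d *\<^sub>C u"
    "c *\<^sub>C d *\<^sub>C u = (c * d) *\<^sub>C u" "1 *\<^sub>C u = u"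
    by (fact right add assoc one)+
qed

end

definition subspace_tensor ::
  "'a::complex_vector set \<Rightarrow> 'b::complex_vector set \<Rightarrow> ('a, 'b) tensor set" where
  "subspace_tensor E F = complex_vector.span {a \<otimes>\<^sub>t b | a b. a \<in> E \<and> b \<in> F}"

section \<open>The operator space projective tensor product\<close>

text \<open>A C*-algebra is an operator space through a faithful \<open>*\<close>-representation on a Hilbert space.
  Faithful representations are isometric, and the resulting matrix norms do not depend on the
  choice of representation.\<close>

definition isometric_star_rep ::
  "('a::cstar_algebra \<Rightarrow> 'h::chilbert_space \<Rightarrow> 'h) \<Rightarrow> bool" where
  "isometric_star_rep \<pi> \<longleftrightarrow>
     (\<forall>a. clinear (\<pi> a) \<and> bounded_linear (\<pi> a) \<and> onorm (\<pi> a) = norm a) \<and>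
     (\<forall>\<xi>. clinear (\<lambda>a. \<pi> a \<xi>)) \<and>
     (\<forall>a b \<xi>. \<pi> (a * b) \<xi> = \<pi> a (\<pi> b \<xi>)) \<and>
     (\<forall>a \<xi> \<eta>. cinner (\<pi> a \<xi>) \<eta> = cinner \<xi> (\<pi> (star a) \<eta>))"

text \<open>Matrices are functions of two indices of which only the entries in range matter.
  \<open>opmat_norm m n T\<close> is the norm of the operator from the n-fold to the m-fold Hilbert space sum
  given by the m by n matrix of operators \<open>T\<close>.\<close>

definition opmat_norm ::
  "nat \<Rightarrow> nat \<Rightarrow> (nat \<Rightarrow> nat \<Rightarrow> 'h::real_normed_vector \<Rightarrow> 'k::real_normed_vector) \<Rightarrow> real" where
  "opmat_norm m n T =
     (SUP \<xi>\<in>{\<xi>. L2_set (\<lambda>j. norm (\<xi> j)) {..<n} \<le> 1}.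
        L2_set (\<lambda>i. norm (\<Sum>j<n. T i j (\<xi> j))) {..<m})"

definition cmat_norm :: "nat \<Rightarrow> nat \<Rightarrow> (nat \<Rightarrow> nat \<Rightarrow> complex) \<Rightarrow> real" where
  "cmat_norm m n \<alpha> = opmat_norm m n (\<lambda>i j z. \<alpha> i j * z)"

definition rep_mat_norm ::
  "('a \<Rightarrow> 'h::real_normed_vector \<Rightarrow> 'h) \<Rightarrow> nat \<Rightarrow> (nat \<Rightarrow> nat \<Rightarrow> 'a) \<Rightarrow> real" where
  "rep_mat_norm \<pi> n v = opmat_norm n n (\<lambda>i j. \<pi> (v i j))"

definition kron_tensor ::
  "nat \<Rightarrow> (nat \<Rightarrow> nat \<Rightarrow> 'a::complex_vector) \<Rightarrow> (nat \<Rightarrow> nat \<Rightarrow> 'b::complex_vector)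
     \<Rightarrow> nat \<Rightarrow> nat \<Rightarrow> ('a, 'b) tensor" where
  "kron_tensor q v w r s = v (r div q) (s div q) \<otimes>\<^sub>t w (r mod q) (s mod q)"

definition op_proj_norm ::
  "('a::cstar_algebra \<Rightarrow> 'h::chilbert_space \<Rightarrow> 'h) \<Rightarrow>
   ('b::cstar_algebra \<Rightarrow> 'k::chilbert_space \<Rightarrow> 'k) \<Rightarrow> ('a, 'b) tensor \<Rightarrow> real" where
  "op_proj_norm \<pi> \<rho> u =
     Inf {cmat_norm 1 (p * q) \<alpha> * rep_mat_norm \<pi> p v * rep_mat_norm \<rho> q w * cmat_norm (p * q) 1 \<beta>
          | p q \<alpha> v w \<beta>.
            u = (\<Sum>r<p * q. \<Sum>s<p * q. (\<alpha> 0 r * \<beta> s 0) *\<^sub>C kron_tensor q v w r s)}"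

text \<open>\<open>is_op_proj_tensor \<pi> \<rho> \<iota>\<close>: the Banach algebra \<open>'x\<close>, together with the embedding \<open>\<iota>\<close> of the
  algebraic tensor product, is the completion of the latter in the operator space projective
  norm; the multiplication of \<open>'x\<close> is the continuous extension of the one determined by
  elementary tensors.  This determines \<open>'x\<close> and \<open>\<iota>\<close> up to isometric isomorphism.\<close>

definition is_op_proj_tensor ::
  "('a::cstar_algebra \<Rightarrow> 'h::chilbert_space \<Rightarrow> 'h) \<Rightarrow>
   ('b::cstar_algebra \<Rightarrow> 'k::chilbert_space \<Rightarrow> 'k) \<Rightarrow>
   (('a, 'b) tensor \<Rightarrow> 'x::complex_banach_algebra) \<Rightarrow> bool" where
  "is_op_proj_tensor \<pi> \<rho> \<iota> \<longleftrightarrow>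
     clinear \<iota> \<and>
     (\<forall>u. norm (\<iota> u) = op_proj_norm \<pi> \<rho> u) \<and>
     closure (range \<iota>) = UNIV \<and>
     (\<forall>a b c d. \<iota> (a \<otimes>\<^sub>t b) * \<iota> (c \<otimes>\<^sub>t d) = \<iota> ((a * c) \<otimes>\<^sub>t (b * d)))"

end

theory Submission
  imports Defs
begin

text \<open>If \<open>A\<close> and \<open>B\<close> have units then so does the completed tensor product, by density of the
  algebraic tensors (\<open>op_proj_tensor_unit\<close>), and in a unital algebra every ideal is modular; that the
  closure of \<open>I \<otimes> J\<close> is an ideal is \<open>two_sided_ideal_closure_subspace_tensor\<close>.

  Conversely, let \<open>E\<close> be a unit modulo the closure of \<open>I \<otimes> J\<close>.  As \<open>I\<close> is closed, proper and modular with
  unit \<open>e\<close> modulo \<open>I\<close>, the Hahn-Banach theorem gives a bounded functional \<open>\<phi>\<close> on \<open>A\<close> that vanishes on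
  \<open>I\<close> and has \<open>\<phi> e = 1\<close> (\<open>modular_ideal_functional\<close>).  Let \<open>R\<close> be the continuous
  extension of the slice map \<open>\<phi> \<otimes> id\<close> to the completion.  It kills the closure of \<open>I \<otimes> J\<close>, and since \<open>\<phi> (e * x) = \<phi> x\<close> it
  satisfies \<open>R ((e \<otimes> b) u) = b R u\<close>.  The element \<open>(e \<otimes> b) E - e \<otimes> b\<close> of the closed ideal is therefore
  mapped to \<open>b R E - b = 0\<close>, and symmetrically \<open>R E b = b\<close>; so \<open>R E\<close> is a unit of \<open>B\<close>
  (\<open>unital_if_modular_closure\<close>).  Slicing by a functional on \<open>B\<close> that vanishes on \<open>J\<close> gives a unit of \<open>A\<close>.

  The analytic point is that slice maps are bounded for the projective operator space norm
  (\<open>norm_left_slice_le\<close>, \<open>norm_right_slice_le\<close>).  This holds because functionals are automatically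
  completely bounded (\<open>functional_completely_bounded\<close>) and a Kronecker product of a scalar matrix with an
  operator matrix has norm at most the product of the norms (\<open>norm_kron_sum_le\<close>).\<close>

section \<open>Sublinear functionals and the Hahn-Banach theorem\<close>

definition sublinear :: "('a::real_vector \<Rightarrow> real) \<Rightarrow> bool" where
  "sublinear p \<longleftrightarrow>
     (\<forall>x y. p (x + y) \<le> p x + p y) \<and> (\<forall>t x. 0 < t \<longrightarrow> p (t *\<^sub>R x) \<le> t * p x)"

lemma sublinearI:
  assumes "\<And>x y. p (x + y) \<le> p x + p y" "\<And>t x. 0 < t \<Longrightarrow> p (t *\<^sub>R x) \<le> t * p x"
  shows "sublinear p"
  using assms by (auto simp: sublinear_def)

lemma sublinear_add: "sublinear p \<Longrightarrow> p (x + y) \<le> p x + p y"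
  by (simp add: sublinear_def)

lemma sublinear_scale:
  assumes "sublinear p" "0 \<le> t"
  shows "p (t *\<^sub>R x) = t * p x"
proof -
  have eq: "p (t *\<^sub>R x) = t * p x" if t: "0 < t" for t x
  proof (rule antisym)
    show "p (t *\<^sub>R x) \<le> t * p x"
      using assms t by (simp add: sublinear_def)
    have "p (inverse t *\<^sub>R t *\<^sub>R x) \<le> inverse t * p (t *\<^sub>R x)"
      using assms(1) t unfolding sublinear_def by (metis positive_imp_inverse_positive)
    with t show "t * p x \<le> p (t *\<^sub>R x)"
      by (simp add: field_simps)
  qed
  have "p 0 = 0"
    using eq[of 2 0] by simp
  with eq[of t x] assms(2) show ?thesis
    by (cases "t = 0") auto
qed

lemma sublinear_zero: "sublinear p \<Longrightarrow> p 0 = 0"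
  using sublinear_scale[of p 0 0] by simp

lemma sublinear_minus: "sublinear p \<Longrightarrow> - p (- x) \<le> p x"
  using sublinear_add[of p x "- x"] sublinear_zero[of p] by simp

lemma sublinear_norm: "sublinear norm"
  by (rule sublinearI) (auto intro: norm_triangle_ineq)

text \<open>The functional \<open>r\<close> is \<open>r x = (INF s\<in>S. p (x + s) - g s)\<close>, the largest sublinear functional below
  \<open>p\<close> that satisfies \<open>r (- s) \<le> - g s\<close> on the convex cone \<open>S\<close>.  The infimum is finite because
  \<open>g \<le> p\<close> on \<open>S\<close> bounds every term below by \<open>- p (- x)\<close>.  With \<open>g = 0\<close> on a subspace and \<open>p\<close> the norm
  it is the distance to the subspace; with \<open>g = p\<close> on a ray it pushes \<open>p\<close> down to a functional that
  is additive along that ray.\<close>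

lemma sublinear_lower:
  fixes p :: "'a::real_vector \<Rightarrow> real"
  assumes p: "sublinear p"
    and S0: "0 \<in> S" and S_add: "\<And>s t. s \<in> S \<Longrightarrow> t \<in> S \<Longrightarrow> s + t \<in> S"
    and S_scale: "\<And>c s. 0 < c \<Longrightarrow> s \<in> S \<Longrightarrow> c *\<^sub>R s \<in> S"
    and g_add: "\<And>s t. s \<in> S \<Longrightarrow> t \<in> S \<Longrightarrow> g (s + t) = g s + g t"
    and g_scale: "\<And>c s. 0 < c \<Longrightarrow> s \<in> S \<Longrightarrow> g (c *\<^sub>R s) = c * g s"
    and g_le: "\<And>s. s \<in> S \<Longrightarrow> g s \<le> p s"
  shows "\<exists>r. sublinear r \<and> r \<le> p \<and> (\<forall>x. \<forall>s\<in>S. r x \<le> p (x + s) - g s) \<and>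
           (\<forall>x b. (\<forall>s\<in>S. b \<le> p (x + s) - g s) \<longrightarrow> b \<le> r x)"
proof -
  define r where "r x = (INF s\<in>S. p (x + s) - g s)" for x
  have bdd: "bdd_below ((\<lambda>s. p (x + s) - g s) ` S)" for x
  proof (rule bdd_belowI2)
    fix s assume "s \<in> S"
    from g_le[OF this] sublinear_add[OF p, of "x + s" "- x"]
    show "- p (- x) \<le> p (x + s) - g s" by simp
  qed
  have le: "r x \<le> p (x + s) - g s" if "s \<in> S" for x s
    unfolding r_def by (rule cINF_lower[OF bdd that])
  have ge: "b \<le> r x" if "\<And>s. s \<in> S \<Longrightarrow> b \<le> p (x + s) - g s" for x b
    unfolding r_def using S0 that by (intro cINF_greatest) auto
  have "g 0 = 0"
    using g_add[OF S0 S0] by simp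
  with le[OF S0] have le_p: "r x \<le> p x" for x
    by simp
  have "sublinear r"
  proof (rule sublinearI)
    fix x y
    have "r (x + y) - r y \<le> p (x + s) - g s" if s: "s \<in> S" for s
    proof -
      have "r (x + y) - (p (x + s) - g s) \<le> r y"
      proof (rule ge)
        fix t assume t: "t \<in> S"
        have "r (x + y) \<le> p ((x + y) + (s + t)) - g (s + t)"
          using le S_add s t by blast
        also have "\<dots> \<le> p (x + s) + p (y + t) - (g s + g t)"
          using sublinear_add[OF p, of "x + s" "y + t"] g_add[OF s t] by (simp add: add_ac)
        finally show "r (x + y) - (p (x + s) - g s) \<le> p (y + t) - g t" by simp
      qed
      then show ?thesis by simp
    qed
    then have "r (x + y) - r y \<le> r x" by (rule ge)
    then show "r (x + y) \<le> r x + r y" by simp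
  next
    fix t :: real and x assume t: "0 < t"
    have "r (t *\<^sub>R x) / t \<le> r x"
    proof (rule ge)
      fix s assume s: "s \<in> S"
      have "r (t *\<^sub>R x) \<le> p (t *\<^sub>R x + t *\<^sub>R s) - g (t *\<^sub>R s)"
        by (rule le) (rule S_scale[OF t s])
      also have "\<dots> = t * (p (x + s) - g s)"
        using sublinear_scale[OF p, of t "x + s"] t g_scale[OF t s]
        by (simp add: scaleR_add_right right_diff_distrib)
      finally show "r (t *\<^sub>R x) / t \<le> p (x + s) - g s"
        using t by (simp add: field_simps)
    qed
    then show "r (t *\<^sub>R x) \<le> t * r x"
      using t by (simp add: field_simps)
  qed
  with le_p le ge show ?thesis
    by (intro exI[of _ r]) (auto simp: le_fun_def)
qed

text \<open>The image of \<open>\<lambda>t. \<bar>t\<bar> *\<^sub>R y\<close> is the closed ray spanned by \<open>y\<close>, on which \<open>p\<close> is additive by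
  homogeneity; the inequality is the case \<open>s = y\<close> of the preceding lemma with \<open>g = p\<close>.\<close>

lemma sublinear_lower_ray:
  fixes p :: "'a::real_vector \<Rightarrow> real"
  assumes p: "sublinear p"
  shows "\<exists>r. sublinear r \<and> r \<le> p \<and> (\<forall>x. r x \<le> p (x + y) - p y)"
proof -
  have add: "p (s + t) = p s + p t" "s + t \<in> range (\<lambda>t. \<bar>t\<bar> *\<^sub>R y)"
    if st: "s \<in> range (\<lambda>t. \<bar>t\<bar> *\<^sub>R y)" "t \<in> range (\<lambda>t. \<bar>t\<bar> *\<^sub>R y)" for s t
  proof -
    from st obtain a b where "s = \<bar>a\<bar> *\<^sub>R y" "t = \<bar>b\<bar> *\<^sub>R y" by auto
    then have *: "s = \<bar>a\<bar> *\<^sub>R y" "t = \<bar>b\<bar> *\<^sub>R y" "s + t = \<bar>\<bar>a\<bar> + \<bar>b\<bar>\<bar> *\<^sub>R y"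
      by (simp_all add: scaleR_add_left)
    show "p (s + t) = p s + p t"
      unfolding *(3) by (simp add: * sublinear_scale[OF p] distrib_right)
    show "s + t \<in> range (\<lambda>t. \<bar>t\<bar> *\<^sub>R y)"
      unfolding *(3) by blast
  qed
  have scale: "c *\<^sub>R s \<in> range (\<lambda>t. \<bar>t\<bar> *\<^sub>R y)"
    if "0 < c" "s \<in> range (\<lambda>t. \<bar>t\<bar> *\<^sub>R y)" for c s
  proof -
    from that(2) obtain a where "s = \<bar>a\<bar> *\<^sub>R y" by auto
    with that(1) have "c *\<^sub>R s = \<bar>c * a\<bar> *\<^sub>R y" by (simp add: abs_mult)
    then show ?thesis by blast
  qed
  have zero: "0 \<in> range (\<lambda>t. \<bar>t\<bar> *\<^sub>R y)"
    by (rule range_eqI[of _ _ 0]) simp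
  have p_scale: "p (c *\<^sub>R s) = c * p s" if "0 < c" "s \<in> range (\<lambda>t. \<bar>t\<bar> *\<^sub>R y)" for c s
    using sublinear_scale[OF p, of c s] that by simp
  obtain r where r: "sublinear r" "r \<le> p"
    "\<forall>x. \<forall>s\<in>range (\<lambda>t. \<bar>t\<bar> *\<^sub>R y). r x \<le> p (x + s) - p s"
    using sublinear_lower[OF p zero add(2) scale add(1) p_scale order_refl] by blast
  moreover have "y \<in> range (\<lambda>t. \<bar>t\<bar> *\<^sub>R y)"
    by (rule range_eqI[of _ _ 1]) simp
  ultimately show ?thesis by blast
qed

text \<open>By minimality the functional obtained from \<open>p\<close> and the ray of \<open>y\<close> is \<open>p\<close> itself, which gives
  \<open>p x + p y \<le> p (x + y)\<close>, the converse of subadditivity.\<close>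

lemma minimal_sublinear_linear:
  fixes p :: "'a::real_vector \<Rightarrow> real"
  assumes p: "sublinear p" and min: "\<And>r. sublinear r \<Longrightarrow> r \<le> p \<Longrightarrow> r = p"
  shows "linear p"
proof -
  have add: "p (x + y) = p x + p y" for x y
  proof (rule antisym)
    show "p (x + y) \<le> p x + p y" by (rule sublinear_add[OF p])
    from sublinear_lower_ray[OF p, of y] min have "p x \<le> p (x + y) - p y"
      by metis
    then show "p x + p y \<le> p (x + y)" by simp
  qed
  have minus: "p (- x) = - p x" for x
    using add[of x "- x"] sublinear_zero[OF p] by simp
  show ?thesis
  proof (rule linearI)
    fix c x
    show "p (c *\<^sub>R x) = c *\<^sub>R p x"
      using sublinear_scale[OF p, of c x] sublinear_scale[OF p, of "- c" x] minus[of "c *\<^sub>R x"]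
      by (cases "0 \<le> c") auto
  qed (rule add)
qed

text \<open>This is the Hahn-Banach theorem: Zorn's lemma yields a minimal sublinear functional below \<open>p\<close>,
  since the pointwise infimum of a chain is again sublinear.\<close>

lemma sublinear_dominates_linear:
  fixes p :: "'a::real_vector \<Rightarrow> real"
  assumes p: "sublinear p"
  obtains f where "linear f" "f \<le> p"
proof -
  let ?A = "{q. sublinear q \<and> q \<le> p}"
  let ?P = "\<lambda>a b :: 'a \<Rightarrow> real. b \<le> a"
  have "\<exists>m\<in>?A. \<forall>a\<in>?A. a \<le> m \<longrightarrow> a = m"
  proof (rule predicate_Zorn[where P = ?P])
    show "partial_order_on ?A (relation_of ?P ?A)"
      by (rule partial_order_on_relation_ofI) auto
  next
    fix C assume C: "C \<in> Chains (relation_of ?P ?A)"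
    have sub: "sublinear q" "q \<le> p" if "q \<in> C" for q
      using C that by (auto simp: Chains_def relation_of_def)
    have chain: "q \<le> r \<or> r \<le> q" if "q \<in> C" "r \<in> C" for q r
      using C that by (auto simp: Chains_def relation_of_def)
    show "\<exists>u\<in>?A. \<forall>a\<in>C. u \<le> a"
    proof (cases "C = {}")
      case True
      then show ?thesis using p by auto
    next
      case False
      define u where "u x = (INF q\<in>C. q x)" for x
      have bdd: "bdd_below ((\<lambda>q. q x) ` C)" for x
      proof (rule bdd_belowI2)
        fix q assume "q \<in> C"
        with sublinear_minus[OF sub(1), of q x] sub(2)[of q]
        show "- p (- x) \<le> q x" by (force simp: le_fun_def dest: spec[of _ "- x"])
      qed
      have le: "u x \<le> q x" if "q \<in> C" for q x
        unfolding u_def by (rule cINF_lower[OF bdd that])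
      have ge: "b \<le> u x" if "\<And>q. q \<in> C \<Longrightarrow> b \<le> q x" for x b
        unfolding u_def using False that by (intro cINF_greatest) auto
      have "sublinear u"
      proof (rule sublinearI)
        fix x y
        have "u (x + y) - u y \<le> q x" if q: "q \<in> C" for q
        proof -
          have "u (x + y) - q x \<le> u y"
          proof (rule ge)
            fix r assume r: "r \<in> C"
            \<comment> \<open>the smaller of two members of the chain bounds both values at once\<close>
            define m where "m = (if q \<le> r then q else r)"
            have m: "m \<in> C" "m \<le> q" "m \<le> r"
              using q r chain[OF q r] by (auto simp: m_def)
            have "u (x + y) \<le> m x + m y"
              using le[OF m(1), of "x + y"] sublinear_add[OF sub(1)[OF m(1)], of x y] by simp
            also have "\<dots> \<le> q x + r y"
              using m(2,3) by (intro add_mono) (auto simp: le_fun_def)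
            finally show "u (x + y) - q x \<le> r y" by simp
          qed
          then show ?thesis by simp
        qed
        then have "u (x + y) - u y \<le> u x" by (rule ge)
        then show "u (x + y) \<le> u x + u y" by simp
      next
        fix t :: real and x assume t: "0 < t"
        have "u (t *\<^sub>R x) / t \<le> u x"
        proof (rule ge)
          fix q assume q: "q \<in> C"
          show "u (t *\<^sub>R x) / t \<le> q x"
            using le[OF q, of "t *\<^sub>R x"] sublinear_scale[OF sub(1)[OF q], of t x] t
            by (simp add: field_simps)
        qed
        then show "u (t *\<^sub>R x) \<le> t * u x"
          using t by (simp add: field_simps)
      qed
      moreover have le_fun: "u \<le> q" if "q \<in> C" for q
        using le[OF that] by (simp add: le_fun_def)
      moreover have "u \<le> p"
      proof -
        from False obtain q where q: "q \<in> C" by blast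
        from le_fun[OF q] sub(2)[OF q] show ?thesis by (rule order_trans)
      qed
      ultimately show ?thesis by blast
    qed
  qed
  then obtain m where m: "sublinear m" "m \<le> p" "\<And>a. sublinear a \<Longrightarrow> a \<le> p \<Longrightarrow> a \<le> m \<Longrightarrow> a = m"
    by blast
  have "linear m"
    using m by (intro minimal_sublinear_linear) (auto intro: order_trans)
  then show ?thesis using m(2) by (rule that)
qed

text \<open>Start from the distance \<open>d\<close> to \<open>S\<close>, which is positive at \<open>e\<close>, and lower it along the ray of \<open>e\<close> to a
  sublinear \<open>r\<close> with \<open>r (- e) \<le> - d e\<close>.  Any linear \<open>f \<le> r\<close> then satisfies \<open>f e \<ge> d e\<close>, and it vanishes
  on \<open>S\<close> because \<open>d\<close> does.\<close>

lemma linear_separating_point_from_closed_subspace: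
  fixes S :: "'a::real_normed_vector set"
  assumes S: "subspace S" "closed S" and e: "e \<notin> S"
  obtains f where "linear f" "\<And>x. f x \<le> norm x" "\<And>s. s \<in> S \<Longrightarrow> f s = 0" "0 < f e"
proof -
  have "\<exists>d. sublinear d \<and> d \<le> norm \<and> (\<forall>x. \<forall>s\<in>S. d x \<le> norm (x + s) - 0) \<and>
      (\<forall>x b. (\<forall>s\<in>S. b \<le> norm (x + s) - 0) \<longrightarrow> b \<le> d x)"
    by (rule sublinear_lower[OF sublinear_norm])
      (simp_all add: subspace_0 subspace_add subspace_scale S(1))
  then obtain d where d: "sublinear d" "d \<le> norm"
    "\<And>x s. s \<in> S \<Longrightarrow> d x \<le> norm (x + s)"
    "\<And>x b. (\<And>s. s \<in> S \<Longrightarrow> b \<le> norm (x + s)) \<Longrightarrow> b \<le> d x"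
    by auto
  from S(2) e obtain \<epsilon> where \<epsilon>: "0 < \<epsilon>" "\<And>s. s \<in> S \<Longrightarrow> \<epsilon> \<le> dist s e"
    by (metis closed_approachable not_le_imp_less)
  have "\<epsilon> \<le> d e"
  proof (rule d(4))
    fix s assume "s \<in> S"
    then have "- s \<in> S" using S(1) by (simp add: subspace_neg)
    from \<epsilon>(2)[OF this] show "\<epsilon> \<le> norm (e + s)"
      by (simp add: dist_norm norm_minus_commute)
  qed
  obtain r where r: "sublinear r" "r \<le> d" "\<And>x. r x \<le> d (x + e) - d e"
    using sublinear_lower_ray[OF d(1), of e] by blast
  obtain f where f: "linear f" "f \<le> r"
    by (rule sublinear_dominates_linear[OF r(1)])
  have f_le: "f x \<le> d x" for x
    using f(2) r(2) by (meson le_fun_def order_trans)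
  have minus: "f (- x) = - f x" for x
    using f(1) by (rule linear_neg)
  show ?thesis
  proof
    show "linear f" by fact
    show "f x \<le> norm x" for x
      using f_le[of x] d(2) by (meson le_fun_def order_trans)
    show "f s = 0" if "s \<in> S" for s
    proof -
      have "- s \<in> S" using S(1) that by (simp add: subspace_neg)
      with that d(3)[of "- s" s] d(3)[of s "- s"] f_le[of s] f_le[of "- s"] minus[of s]
      show ?thesis by simp
    qed
    have "f (- e) \<le> r (- e)" using f(2) by (simp add: le_fun_def)
    also have "\<dots> \<le> - d e" using r(3)[of "- e"] sublinear_zero[OF d(1)] by simp
    finally show "0 < f e" using \<open>\<epsilon> \<le> d e\<close> \<epsilon>(1) minus[of e] by simp
  qed
qed

section \<open>Complex linear maps and functionals\<close>

lemma clinearI: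
  assumes "\<And>x y. f (x + y) = f x + f y" "\<And>c x. f (c *\<^sub>C x) = c *\<^sub>C f x"
  shows "clinear f"
  using assms by (simp add: Vector_Spaces.linear_iff complex_vector.vector_space_axioms)

lemma clinear_module_hom: "clinear f \<Longrightarrow> module_hom scaleC scaleC f"
  by (simp add: module_hom_iff_linear)

lemmas clinear_add = module_hom.add[OF clinear_module_hom]
  and clinear_scaleC = module_hom.scale[OF clinear_module_hom]
  and clinear_zero = module_hom.zero[OF clinear_module_hom]
  and clinear_diff = module_hom.diff[OF clinear_module_hom]
  and clinear_sum = module_hom.sum[OF clinear_module_hom]

lemma bounded_linear_scaleC: "bounded_linear (\<lambda>x::'a::complex_normed_vector. c *\<^sub>C x)"
proof (rule bounded_linear_intro[where K = "cmod c"])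
  show "c *\<^sub>C (r *\<^sub>R x) = r *\<^sub>R (c *\<^sub>C x)" for r and x :: 'a
    by (simp add: scaleR_scaleC scaleC_scaleC mult.commute)
qed (simp_all add: scaleC_add_right norm_scaleC)

text \<open>With the scalars themselves as a normed space, functionals are a case of \<open>clinear\<close>.\<close>

instantiation complex :: complex_normed_vector
begin

definition scaleC_complex :: "complex \<Rightarrow> complex \<Rightarrow> complex"
  where "scaleC_complex = (*)"

instance
  by intro_classes
    (simp_all add: scaleC_complex_def algebra_simps norm_mult scaleR_conv_of_real)

end

lemma clinear_complexify:
  fixes f :: "'a::complex_vector \<Rightarrow> real"
  assumes f: "linear f"
  shows "clinear (\<lambda>x. Complex (f x) (- f (\<i> *\<^sub>C x)))"
proof (rule clinearI)
  fix x y
  show "Complex (f (x + y)) (- f (\<i> *\<^sub>C (x + y))) =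
      Complex (f x) (- f (\<i> *\<^sub>C x)) + Complex (f y) (- f (\<i> *\<^sub>C y))"
    by (simp add: scaleC_add_right linear_add[OF f] complex_eq_iff)
next
  fix c x
  have c: "f (c *\<^sub>C y) = Re c * f y + Im c * f (\<i> *\<^sub>C y)" for c y
  proof -
    have "c *\<^sub>C y = Re c *\<^sub>R y + Im c *\<^sub>R (\<i> *\<^sub>C y)"
      by (simp add: scaleR_scaleC scaleC_scaleC flip: scaleC_add_left)
        (simp add: complex_eq_iff)
    then show ?thesis
      by (simp add: linear_add[OF f] linear_scale[OF f])
  qed
  show "Complex (f (c *\<^sub>C x)) (- f (\<i> *\<^sub>C (c *\<^sub>C x))) =
      c *\<^sub>C Complex (f x) (- f (\<i> *\<^sub>C x))"
    using c[of c x] c[of "\<i> * c" x]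
    by (simp add: scaleC_complex_def complex_eq_iff scaleC_scaleC)
qed

lemma complex_subspace_imp_subspace:
  fixes S :: "'a::complex_vector set"
  assumes "complex_vector.subspace S"
  shows "subspace S"
  using assms by (auto simp: subspace_def complex_vector.subspace_def scaleR_scaleC)

text \<open>The complexification of the real functional is bounded by twice the norm.  The exact constant is
  immaterial for continuity of the slice maps, so it is left as an unspecified \<open>C\<close>.\<close>

lemma clinear_separating_point_from_closed_subspace:
  fixes S :: "'a::complex_normed_vector set"
  assumes S: "complex_vector.subspace S" "closed S" and e: "e \<notin> S"
  obtains \<phi> :: "'a \<Rightarrow> complex" and C where
    "clinear \<phi>" "0 < C" "\<And>x. cmod (\<phi> x) \<le> C * norm x" "\<And>s. s \<in> S \<Longrightarrow> \<phi> s = 0" "\<phi> e = 1"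
proof -
  from linear_separating_point_from_closed_subspace[OF complex_subspace_imp_subspace[OF S(1)] S(2) e]
  obtain f where f: "linear f" "\<And>x. f x \<le> norm x" "\<And>s. s \<in> S \<Longrightarrow> f s = 0" "0 < f e"
    by blast
  have abs_f: "\<bar>f x\<bar> \<le> norm x" for x
    using f(2)[of x] f(2)[of "- x"] linear_neg[OF f(1), of x] by simp
  define g where "g x = Complex (f x) (- f (\<i> *\<^sub>C x))" for x
  have g: "clinear g"
    unfolding g_def by (rule clinear_complexify[OF f(1)])
  have ge: "g e \<noteq> 0"
    using f(4) by (auto simp: g_def complex_eq_iff)
  have bound: "cmod (g x) \<le> 2 * norm x" for x
    using cmod_le[of "g x"] abs_f[of x] abs_f[of "\<i> *\<^sub>C x"] by (simp add: g_def norm_scaleC)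
  show ?thesis
  proof (rule that[of "\<lambda>x. g x / g e" "2 / cmod (g e)"])
    show "clinear (\<lambda>x. g x / g e)"
      by (rule clinearI)
        (simp_all add: clinear_add[OF g] clinear_scaleC[OF g] scaleC_complex_def add_divide_distrib)
    show "cmod (g x / g e) \<le> 2 / cmod (g e) * norm x" for x
      using bound[of x] ge by (simp add: norm_divide field_simps)
    show "g s / g e = 0" if "s \<in> S" for s
    proof -
      have "\<i> *\<^sub>C s \<in> S" using S(1) that by (rule complex_vector.subspace_scale)
      with that f(3) have "g s = 0" by (simp add: g_def complex_eq_iff)
      then show ?thesis by simp
    qed
  qed (use ge in simp_all)
qed

text \<open>A unit \<open>e\<close> modulo a proper ideal lies outside it, as otherwise every \<open>x = x * e - (x * e - x)\<close>
  would belong to the ideal.  A functional that vanishes on the ideal does not distinguish \<open>e * x\<close>,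
  \<open>x * e\<close> and \<open>x\<close>.\<close>

lemma modular_ideal_functional:
  fixes I :: "'a::complex_banach_algebra set"
  assumes "closed I" "modular_ideal I" "I \<noteq> UNIV"
  obtains \<phi> :: "'a \<Rightarrow> complex" and C and e where
    "clinear \<phi>" "0 < C" "\<And>x. cmod (\<phi> x) \<le> C * norm x" "\<And>x. x \<in> I \<Longrightarrow> \<phi> x = 0"
    "\<phi> e = 1" "\<And>x. \<phi> (e * x) = \<phi> x" "\<And>x. \<phi> (x * e) = \<phi> x"
proof -
  from assms(2) obtain e where ideal: "two_sided_ideal I"
    and e: "\<And>x. x * e - x \<in> I" "\<And>x. e * x - x \<in> I"
    by (auto simp: modular_ideal_def)
  then have S: "complex_vector.subspace I"
    by (simp add: two_sided_ideal_def)
  have "e \<notin> I"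
  proof
    assume "e \<in> I"
    have "x \<in> I" for x
    proof -
      have "x * e \<in> I" using ideal \<open>e \<in> I\<close> by (simp add: two_sided_ideal_def)
      from complex_vector.subspace_diff[OF S this e(1)[of x]] show ?thesis by simp
    qed
    with assms(3) show False by blast
  qed
  from clinear_separating_point_from_closed_subspace[OF S assms(1) this]
  obtain \<phi> C where \<phi>: "clinear \<phi>" "0 < C" "\<And>x. cmod (\<phi> x) \<le> C * norm x"
    "\<And>s. s \<in> I \<Longrightarrow> \<phi> s = 0" "\<phi> e = 1" by blast
  have "\<phi> (e * x) = \<phi> x" "\<phi> (x * e) = \<phi> x" for x
    using \<phi>(4)[OF e(1)[of x]] \<phi>(4)[OF e(2)[of x]] by (simp_all add: clinear_diff[OF \<phi>(1)])
  with \<phi> show ?thesis by (intro that)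
qed

section \<open>Linear maps on the algebraic tensor product\<close>

lemma tensor_induct [case_names zero add]:
  assumes "P 0" "\<And>a b u. P u \<Longrightarrow> P (u + a \<otimes>\<^sub>t b)"
  shows "P u"
proof (induction u rule: tensor.abs_induct)
  case (1 M)
  show ?case
  proof (induction M)
    case empty
    with assms(1) show ?case by (simp add: zero_tensor.abs_eq)
  next
    case (add x M)
    from assms(2)[OF this, of "fst x" "snd x"] show ?case
      by (simp add: elem_tensor.abs_eq plus_tensor.abs_eq)
  qed
qed

text \<open>The sum is taken over an arbitrary representative of \<open>u\<close>; for bilinear \<open>f\<close> the choice does not
  matter, and \<open>tensor_lift f\<close> is the linear map given by the universal property of the tensor
  product.\<close>

definition tensor_lift ::
  "('a::complex_vector \<Rightarrow> 'b::complex_vector \<Rightarrow> 'c::complex_vector) \<Rightarrow> ('a, 'b) tensor \<Rightarrow> 'c" where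
  "tensor_lift f u = (\<Sum>(a, b)\<in>#rep_tensor u. f a b)"

lemma sum_mset_tensor_eq_cong:
  assumes "tensor_eq M N" and "\<And>b. clinear (\<lambda>a. f a b)" "\<And>a. clinear (f a)"
  shows "(\<Sum>(a, b)\<in>#M. f a b) = (\<Sum>(a, b)\<in>#N. f a b)"
  using assms(1)
  by induction
    (simp_all add: clinear_add[OF assms(2)] clinear_add[OF assms(3)] clinear_zero[OF assms(2)]
      clinear_scaleC[OF assms(2)] clinear_scaleC[OF assms(3)])

lemma
  assumes f: "\<And>b. clinear (\<lambda>a. f a b)" "\<And>a. clinear (f a)"
  shows clinear_tensor_lift: "clinear (tensor_lift f)"
    and tensor_lift_elem_tensor: "tensor_lift f (a \<otimes>\<^sub>t b) = f a b"
proof -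
  have abs: "tensor_lift f (abs_tensor M) = (\<Sum>(a, b)\<in>#M. f a b)" for M
    unfolding tensor_lift_def
    by (rule sum_mset_tensor_eq_cong[OF _ f])
      (rule Quotient3_rep_abs[OF Quotient3_tensor], rule tensor_eq.refl)
  show "tensor_lift f (a \<otimes>\<^sub>t b) = f a b"
    by (simp add: elem_tensor.abs_eq abs)
  show "clinear (tensor_lift f)"
  proof (rule clinearI)
    show "tensor_lift f (u + v) = tensor_lift f u + tensor_lift f v" for u v
      by (induction u rule: tensor.abs_induct, induction v rule: tensor.abs_induct)
        (simp add: plus_tensor.abs_eq abs)
    show "tensor_lift f (c *\<^sub>C u) = c *\<^sub>C tensor_lift f u" for c u
    proof (induction u rule: tensor.abs_induct)
      case (1 M)
      have "(\<Sum>(a, b)\<in>#image_mset (map_prod (scaleC c) id) M. f a b) = c *\<^sub>C (\<Sum>(a, b)\<in>#M. f a b)"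
        by (induction M)
          (auto simp: scaleC_add_right clinear_scaleC[OF f(1)] complex_vector.scale_zero_right)
      then show ?case by (simp add: scaleC_tensor.abs_eq abs)
    qed
  qed
qed

lemma tensor_eq_sum_elem_tensors: "\<exists>n a b. u = (\<Sum>i<n::nat. a i \<otimes>\<^sub>t b i)"
proof (induction u rule: tensor_induct)
  case zero
  show ?case by (rule exI[of _ 0]) simp
next
  case (add x y u)
  then obtain n a b where "u = (\<Sum>i<n::nat. a i \<otimes>\<^sub>t b i)" by blast
  then have "u + x \<otimes>\<^sub>t y = (\<Sum>i<Suc n. (a(n := x)) i \<otimes>\<^sub>t (b(n := y)) i)"
    by simp
  then show ?case by blast
qed

section \<open>Matrix norms\<close>

lemma opmat_norm_bdd_above:
  fixes T :: "nat \<Rightarrow> nat \<Rightarrow> 'h::real_normed_vector \<Rightarrow> 'k::real_normed_vector"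
  assumes T: "\<And>i j. bounded_linear (T i j)"
  shows "bdd_above ((\<lambda>\<xi>. L2_set (\<lambda>i. norm (\<Sum>j<n. T i j (\<xi> j))) {..<m}) `
           {\<xi>. L2_set (\<lambda>j. norm (\<xi> j)) {..<n} \<le> 1})"
proof (rule bdd_aboveI2)
  fix \<xi> :: "nat \<Rightarrow> 'h" assume \<xi>: "\<xi> \<in> {\<xi>. L2_set (\<lambda>j. norm (\<xi> j)) {..<n} \<le> 1}"
  have entry: "norm (T i j (\<xi> j)) \<le> onorm (T i j)" if "j < n" for i j
  proof -
    have "norm (\<xi> j) \<le> 1"
      using member_le_L2_set[of "{..<n}" j "\<lambda>j. norm (\<xi> j)"] \<xi> that by simp
    with onorm[OF T, of i j "\<xi> j"] onorm_pos_le[OF T, of i j] show ?thesis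
      by (meson dual_order.trans mult_left_le)
  qed
  have "L2_set (\<lambda>i. norm (\<Sum>j<n. T i j (\<xi> j))) {..<m} \<le> (\<Sum>i<m. norm (\<Sum>j<n. T i j (\<xi> j)))"
    by (rule L2_set_le_sum) simp
  also have "\<dots> \<le> (\<Sum>i<m. \<Sum>j<n. onorm (T i j))"
    by (intro sum_mono order_trans[OF norm_sum] entry) auto
  finally show "L2_set (\<lambda>i. norm (\<Sum>j<n. T i j (\<xi> j))) {..<m} \<le> (\<Sum>i<m. \<Sum>j<n. onorm (T i j))" .
qed

lemma opmat_norm_nonneg:
  assumes T: "\<And>i j. bounded_linear (T i j)"
  shows "0 \<le> opmat_norm m n T"
  unfolding opmat_norm_def
  by (rule cSUP_upper2[OF opmat_norm_bdd_above[OF T], of "\<lambda>_. 0"]) (simp_all add: L2_set_0')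

lemma L2_set_apply_le_opmat_norm:
  assumes T: "\<And>i j. bounded_linear (T i j)"
  shows "L2_set (\<lambda>i. norm (\<Sum>j<n. T i j (\<xi> j))) {..<m} \<le>
         opmat_norm m n T * L2_set (\<lambda>j. norm (\<xi> j)) {..<n}"
proof -
  let ?c = "L2_set (\<lambda>j. norm (\<xi> j)) {..<n}"
  interpret T: bounded_linear "T i j" for i j by (rule T)
  show ?thesis
  proof (cases "?c = 0")
    case True
    then have "\<xi> j = 0" if "j < n" for j
      using that by (simp add: L2_set_eq_0_iff)
    then show ?thesis
      using True by (simp add: T.zero L2_set_0')
  next
    case False
    then have c: "0 < ?c" by (simp add: order_less_le)
    \<comment> \<open>the supremum in the operator norm ranges over the unit ball, so normalise\<close>
    define \<eta> where "\<eta> j = inverse ?c *\<^sub>R \<xi> j" for j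
    have "L2_set (\<lambda>j. norm (\<eta> j)) {..<n} = inverse ?c * ?c"
      using c by (simp add: \<eta>_def L2_set_right_distrib)
    then have "L2_set (\<lambda>i. norm (\<Sum>j<n. T i j (\<eta> j))) {..<m} \<le> opmat_norm m n T"
      unfolding opmat_norm_def using c
      by (intro cSUP_upper[OF _ opmat_norm_bdd_above[OF T]]) simp
    moreover have "norm (\<Sum>j<n. T i j (\<eta> j)) = inverse ?c * norm (\<Sum>j<n. T i j (\<xi> j))" for i
      using c by (simp add: \<eta>_def T.scale flip: scaleR_right.sum)
    ultimately have "inverse ?c * L2_set (\<lambda>i. norm (\<Sum>j<n. T i j (\<xi> j))) {..<m} \<le> opmat_norm m n T"
      using c by (simp add: L2_set_right_distrib)
    then show ?thesis
      using c by (simp add: field_simps)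
  qed
qed

lemma cmat_norm_nonneg: "0 \<le> cmat_norm m n \<alpha>"
  unfolding cmat_norm_def by (rule opmat_norm_nonneg) (rule bounded_linear_mult_right)

lemma L2_set_apply_le_cmat_norm:
  "L2_set (\<lambda>i. cmod (\<Sum>j<n. \<alpha> i j * x j)) {..<m} \<le>
     cmat_norm m n \<alpha> * L2_set (\<lambda>j. cmod (x j)) {..<n}"
  unfolding cmat_norm_def
  by (rule L2_set_apply_le_opmat_norm) (rule bounded_linear_mult_right)

lemma square_le_imp_le:
  assumes "(x::real)\<^sup>2 \<le> c * x" "0 \<le> x" "0 \<le> c"
  shows "x \<le> c"
  using assms by (cases "x = 0") (auto simp: power2_eq_square)

text \<open>Apply the row to its own conjugate.\<close>

lemma L2_set_row_le_cmat_norm: "L2_set (\<lambda>r. cmod (\<alpha> 0 r)) {..<n} \<le> cmat_norm 1 n \<alpha>"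
proof (rule square_le_imp_le)
  have "(\<Sum>r<n. \<alpha> 0 r * cnj (\<alpha> 0 r)) = of_real ((L2_set (\<lambda>r. cmod (\<alpha> 0 r)) {..<n})\<^sup>2)"
    by (simp add: L2_set_def sum_nonneg complex_norm_square del: of_real_power)
  then have eq: "cmod (\<Sum>r<n. \<alpha> 0 r * cnj (\<alpha> 0 r)) = (L2_set (\<lambda>r. cmod (\<alpha> 0 r)) {..<n})\<^sup>2"
    by (simp del: of_real_power)
  have "cmod (\<Sum>r<n. \<alpha> 0 r * cnj (\<alpha> 0 r)) \<le>
      L2_set (\<lambda>i. cmod (\<Sum>r<n. \<alpha> i r * cnj (\<alpha> 0 r))) {..<1}"
    by (rule member_le_L2_set[of "{..<1}" 0 "\<lambda>i. cmod (\<Sum>r<n. \<alpha> i r * cnj (\<alpha> 0 r))"]) simp_all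
  also have "\<dots> \<le> cmat_norm 1 n \<alpha> * L2_set (\<lambda>r. cmod (cnj (\<alpha> 0 r))) {..<n}"
    by (rule L2_set_apply_le_cmat_norm)
  finally show "(L2_set (\<lambda>r. cmod (\<alpha> 0 r)) {..<n})\<^sup>2 \<le>
      cmat_norm 1 n \<alpha> * L2_set (\<lambda>r. cmod (\<alpha> 0 r)) {..<n}"
    by (simp only: eq complex_mod_cnj)
qed (simp_all add: cmat_norm_nonneg)

lemma L2_set_column_le_cmat_norm: "L2_set (\<lambda>s. cmod (\<beta> s 0)) {..<n} \<le> cmat_norm n 1 \<beta>"
  using L2_set_apply_le_cmat_norm[where m = n and n = 1 and \<alpha> = \<beta> and x = "\<lambda>_. 1"]
  by (simp add: lessThan_Suc)

section \<open>Slice maps\<close>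

lemma isometric_star_repD:
  assumes "isometric_star_rep \<pi>"
  shows "clinear (\<pi> a)" "bounded_linear (\<pi> a)" "onorm (\<pi> a) = norm a" "clinear (\<lambda>a. \<pi> a \<xi>)"
  using assms by (simp_all add: isometric_star_rep_def)

lemma norm_le_if_rep_le:
  assumes "isometric_star_rep \<pi>" "0 \<le> K" "\<And>\<xi>. norm (\<pi> a \<xi>) \<le> K * norm \<xi>"
  shows "norm a \<le> K"
  using onorm_bound[of K "\<pi> a"] assms by (simp add: isometric_star_repD(3))

lemma rep_mat_norm_nonneg:
  assumes "isometric_star_rep \<pi>"
  shows "0 \<le> rep_mat_norm \<pi> n v"
  unfolding rep_mat_norm_def by (rule opmat_norm_nonneg) (rule isometric_star_repD(2)[OF assms])

lemma L2_set_apply_le_rep_mat_norm: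
  assumes "isometric_star_rep \<pi>"
  shows "L2_set (\<lambda>i. norm (\<Sum>j<n. \<pi> (v i j) (\<xi> j))) {..<n} \<le>
         rep_mat_norm \<pi> n v * L2_set (\<lambda>j. norm (\<xi> j)) {..<n}"
  unfolding rep_mat_norm_def
  by (rule L2_set_apply_le_opmat_norm) (rule isometric_star_repD(2)[OF assms])

lemma norm_sum_scaleC_le:
  fixes y :: "'i \<Rightarrow> 'h::complex_normed_vector"
  shows "norm (\<Sum>i\<in>A. c i *\<^sub>C y i) \<le> L2_set (\<lambda>i. cmod (c i)) A * L2_set (\<lambda>i. norm (y i)) A"
proof -
  have "norm (\<Sum>i\<in>A. c i *\<^sub>C y i) \<le> (\<Sum>i\<in>A. \<bar>cmod (c i)\<bar> * \<bar>norm (y i)\<bar>)"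
    by (rule order_trans[OF norm_sum]) (simp add: norm_scaleC)
  also have "\<dots> \<le> L2_set (\<lambda>i. cmod (c i)) A * L2_set (\<lambda>i. norm (y i)) A"
    by (rule L2_set_mult_ineq)
  finally show ?thesis .
qed

text \<open>A functional is completely bounded with its bound as an ordinary functional.  For a vector \<open>x\<close> let
  \<open>y\<close> be its image under the scalar matrix \<open>\<phi> (v i j)\<close>.  Then \<open>\<parallel>y\<parallel>\<^sup>2\<close> is the value of \<open>\<phi>\<close> at the
  single element \<open>a = y\<^sup>* v x\<close> of the algebra, whose norm is at most the product of the norms of
  \<open>y\<close>, \<open>v\<close> and \<open>x\<close>.\<close>

lemma functional_completely_bounded:
  fixes \<phi> :: "'a::cstar_algebra \<Rightarrow> complex"
  assumes \<pi>: "isometric_star_rep \<pi>" and \<phi>: "clinear \<phi>"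
    and C: "0 \<le> C" "\<And>a. cmod (\<phi> a) \<le> C * norm a"
  shows "L2_set (\<lambda>i. cmod (\<Sum>j<n. \<phi> (v i j) * x j)) {..<n} \<le>
         C * rep_mat_norm \<pi> n v * L2_set (\<lambda>j. cmod (x j)) {..<n}"
proof -
  define y where "y i = (\<Sum>j<n. \<phi> (v i j) * x j)" for i
  define a where "a = (\<Sum>i<n. cnj (y i) *\<^sub>C (\<Sum>j<n. x j *\<^sub>C v i j))"
  let ?X = "L2_set (\<lambda>j. cmod (x j)) {..<n}" and ?Y = "L2_set (\<lambda>i. cmod (y i)) {..<n}"
  let ?V = "rep_mat_norm \<pi> n v"
  note V = rep_mat_norm_nonneg[OF \<pi>, of n v]
  have "norm a \<le> ?Y * ?V * ?X"
  proof (rule norm_le_if_rep_le[OF \<pi>])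
    show "0 \<le> ?Y * ?V * ?X" by (simp add: V)
    fix \<xi>
    have "\<pi> a \<xi> = (\<Sum>i<n. cnj (y i) *\<^sub>C (\<Sum>j<n. \<pi> (v i j) (x j *\<^sub>C \<xi>)))"
      by (simp add: a_def clinear_sum[OF isometric_star_repD(4)[OF \<pi>]]
          clinear_scaleC[OF isometric_star_repD(4)[OF \<pi>]]
          clinear_scaleC[OF isometric_star_repD(1)[OF \<pi>]])
    also have "norm \<dots> \<le> L2_set (\<lambda>i. cmod (cnj (y i))) {..<n} *
        L2_set (\<lambda>i. norm (\<Sum>j<n. \<pi> (v i j) (x j *\<^sub>C \<xi>))) {..<n}"
      by (rule norm_sum_scaleC_le)
    also have "\<dots> \<le> ?Y * (?V * L2_set (\<lambda>j. norm (x j *\<^sub>C \<xi>)) {..<n})"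
      unfolding complex_mod_cnj by (intro mult_left_mono L2_set_apply_le_rep_mat_norm[OF \<pi>]) simp
    also have "\<dots> = ?Y * ?V * ?X * norm \<xi>"
      by (simp add: norm_scaleC flip: L2_set_left_distrib)
    finally show "norm (\<pi> a \<xi>) \<le> ?Y * ?V * ?X * norm \<xi>" .
  qed
  have "\<phi> a = (\<Sum>i<n. cnj (y i) * y i)"
    by (simp add: a_def clinear_sum[OF \<phi>] clinear_scaleC[OF \<phi>] scaleC_complex_def y_def mult.commute)
  also have "\<dots> = of_real (?Y\<^sup>2)"
    by (simp add: L2_set_def sum_nonneg complex_norm_square mult.commute del: of_real_power)
  finally have "?Y\<^sup>2 = cmod (\<phi> a)"
    by (simp del: of_real_power)
  also have "\<dots> \<le> C * norm a" by (rule C(2))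
  also have "\<dots> \<le> C * (?Y * ?V * ?X)"
    by (rule mult_left_mono) fact+
  finally have "?Y\<^sup>2 \<le> (C * ?V * ?X) * ?Y" by (simp add: mult_ac)
  then have "?Y \<le> C * ?V * ?X"
    by (rule square_le_imp_le) (simp_all add: V C(1))
  then show ?thesis by (simp add: y_def)
qed

lemma L2_set_Times_power2:
  assumes "finite A" "finite B"
  shows "(L2_set f (A \<times> B))\<^sup>2 = (\<Sum>x\<in>A. (L2_set (\<lambda>y. f (x, y)) B)\<^sup>2)"
  using assms by (simp add: L2_set_def sum_nonneg sum.cartesian_product)

lemma L2_set_Times_swap:
  assumes "finite A" "finite B"
  shows "L2_set f (A \<times> B) = L2_set (\<lambda>(y, x). f (x, y)) (B \<times> A)"
proof -
  have "(L2_set f (A \<times> B))\<^sup>2 = (\<Sum>x\<in>A. \<Sum>y\<in>B. (f (x, y))\<^sup>2)"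
    using assms by (simp add: L2_set_Times_power2) (simp add: L2_set_def sum_nonneg)
  also have "\<dots> = (\<Sum>y\<in>B. \<Sum>x\<in>A. (f (x, y))\<^sup>2)" by (rule sum.swap)
  also have "\<dots> = (L2_set (\<lambda>(y, x). f (x, y)) (B \<times> A))\<^sup>2"
    using assms by (simp add: L2_set_Times_power2) (simp add: L2_set_def sum_nonneg)
  finally show ?thesis by simp
qed

lemma L2_set_Times_le:
  fixes f g :: "'i \<times> 'j \<Rightarrow> real"
  assumes "finite A" "finite B" "finite B'" "0 \<le> K"
    and "\<And>x. x \<in> A \<Longrightarrow> L2_set (\<lambda>y. f (x, y)) B \<le> K * L2_set (\<lambda>y. g (x, y)) B'"
  shows "L2_set f (A \<times> B) \<le> K * L2_set g (A \<times> B')"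
proof (rule power2_le_imp_le)
  have "(L2_set f (A \<times> B))\<^sup>2 \<le> (\<Sum>x\<in>A. (K * L2_set (\<lambda>y. g (x, y)) B')\<^sup>2)"
    unfolding L2_set_Times_power2[OF assms(1,2)] by (intro sum_mono power_mono assms(5)) simp_all
  also have "\<dots> = (K * L2_set g (A \<times> B'))\<^sup>2"
    by (simp add: power_mult_distrib L2_set_Times_power2[OF assms(1,3)] sum_distrib_left)
  finally show "(L2_set f (A \<times> B))\<^sup>2 \<le> (K * L2_set g (A \<times> B'))\<^sup>2" .
qed (simp add: assms(4))

text \<open>The left-hand side is \<open>\<alpha> (M \<otimes> T) \<beta>\<close> applied to \<open>\<theta>\<close>, and \<open>M \<otimes> T\<close> factors as
  \<open>(1 \<otimes> T) (M \<otimes> 1)\<close>.  So \<open>M\<close> acts first, along the first index of \<open>\<beta>\<close>, giving \<open>z\<close>; then \<open>T\<close> acts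
  along the second index, giving \<open>y\<close>; the Cauchy-Schwarz inequality disposes of \<open>\<alpha>\<close>.\<close>

lemma norm_kron_sum_le:
  fixes M :: "nat \<Rightarrow> nat \<Rightarrow> complex"
    and T :: "nat \<Rightarrow> nat \<Rightarrow> 'h::complex_normed_vector \<Rightarrow> 'h"
  assumes T: "\<And>k l. clinear (T k l)" and nonneg: "0 \<le> D" "0 \<le> W"
    and M_le: "\<And>x. L2_set (\<lambda>i. cmod (\<Sum>j<p. M i j * x j)) {..<p} \<le> D * L2_set (\<lambda>j. cmod (x j)) {..<p}"
    and T_le: "\<And>\<xi>. L2_set (\<lambda>k. norm (\<Sum>l<q. T k l (\<xi> l))) {..<q} \<le> W * L2_set (\<lambda>l. norm (\<xi> l)) {..<q}"
  shows "norm (\<Sum>i<p. \<Sum>k<q. \<Sum>j<p. \<Sum>l<q. (\<alpha> i k * \<beta> j l * M i j) *\<^sub>C T k l \<theta>) \<le>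
         L2_set (\<lambda>(i, k). cmod (\<alpha> i k)) ({..<p} \<times> {..<q}) * D * W *
         L2_set (\<lambda>(j, l). cmod (\<beta> j l)) ({..<p} \<times> {..<q}) * norm \<theta>"
    (is "norm ?s \<le> ?A * D * W * ?B * norm \<theta>")
proof -
  define z where "z i l = (\<Sum>j<p. M i j * \<beta> j l)" for i l
  define y where "y i k = (\<Sum>l<q. T k l (z i l *\<^sub>C \<theta>))" for i k
  have y: "(\<Sum>j<p. \<Sum>l<q. (\<alpha> i k * \<beta> j l * M i j) *\<^sub>C T k l \<theta>) = \<alpha> i k *\<^sub>C y i k" for i k
    by (subst sum.swap)
      (simp add: y_def z_def clinear_scaleC[OF T] clinear_sum[OF T] complex_vector.scale_sum_left
        complex_vector.scale_sum_right scaleC_scaleC mult_ac)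
  have "?s = (\<Sum>(i, k)\<in>{..<p} \<times> {..<q}. \<alpha> i k *\<^sub>C y i k)"
    unfolding y by (rule sum.cartesian_product)
  also have "norm \<dots> \<le> ?A * L2_set (\<lambda>(i, k). norm (y i k)) ({..<p} \<times> {..<q})"
    using norm_sum_scaleC_le[of "\<lambda>(i, k). \<alpha> i k" "\<lambda>(i, k). y i k" "{..<p} \<times> {..<q}"]
    by (simp add: case_prod_beta')
  also have "\<dots> \<le> ?A * (W * L2_set (\<lambda>(i, l). cmod (z i l) * norm \<theta>) ({..<p} \<times> {..<q}))"
  proof (intro mult_left_mono L2_set_Times_le)
    fix i
    show "L2_set (\<lambda>k. case (i, k) of (i, k) \<Rightarrow> norm (y i k)) {..<q} \<le>
        W * L2_set (\<lambda>l. case (i, l) of (i, l) \<Rightarrow> cmod (z i l) * norm \<theta>) {..<q}"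
      using T_le[of "\<lambda>l. z i l *\<^sub>C \<theta>"] by (simp add: y_def norm_scaleC)
  qed (simp_all add: nonneg)
  also have "L2_set (\<lambda>(i, l). cmod (z i l) * norm \<theta>) ({..<p} \<times> {..<q}) =
      L2_set (\<lambda>(l, i). cmod (z i l)) ({..<q} \<times> {..<p}) * norm \<theta>"
    by (subst L2_set_Times_swap) (simp_all add: L2_set_left_distrib case_prod_beta')
  also have "?A * (W * (L2_set (\<lambda>(l, i). cmod (z i l)) ({..<q} \<times> {..<p}) * norm \<theta>)) \<le>
      ?A * (W * (D * L2_set (\<lambda>(l, j). cmod (\<beta> j l)) ({..<q} \<times> {..<p}) * norm \<theta>))"
  proof (intro mult_left_mono mult_right_mono L2_set_Times_le)
    fix l
    show "L2_set (\<lambda>i. case (l, i) of (l, i) \<Rightarrow> cmod (z i l)) {..<p} \<le>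
        D * L2_set (\<lambda>j. case (l, j) of (l, j) \<Rightarrow> cmod (\<beta> j l)) {..<p}"
      using M_le[of "\<lambda>j. \<beta> j l"] by (simp add: z_def)
  qed (simp_all add: nonneg)
  also have "L2_set (\<lambda>(l, j). cmod (\<beta> j l)) ({..<q} \<times> {..<p}) = ?B"
    by (subst L2_set_Times_swap) (simp_all add: case_prod_beta')
  finally show ?thesis by (simp add: mult_ac)
qed

lemma sum_div_mod:
  fixes f :: "nat \<Rightarrow> nat \<Rightarrow> 'a::comm_monoid_add"
  shows "(\<Sum>r<p * q. f (r div q) (r mod q)) = (\<Sum>i<p. \<Sum>k<q. f i k)"
  unfolding sum_mult_product by (rule sum.cong[OF HOL.refl], rule sum.cong[OF HOL.refl]) auto

lemma L2_set_div_mod: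
  "L2_set (\<lambda>(i, k). f (k + i * q)) ({..<p} \<times> {..<q}) = L2_set f {..<p * q :: nat}"
proof -
  have "(\<Sum>r<p * q. (f r)\<^sup>2) = (\<Sum>i<p. \<Sum>k<q. (f (k + i * q))\<^sup>2)"
    by (rule sum_mult_product)
  then show ?thesis
    by (simp add: L2_set_def sum.cartesian_product case_prod_beta')
qed

lemma L2_set_div_mod_swap:
  "L2_set (\<lambda>(k, i). f (k + i * q)) ({..<q} \<times> {..<p}) = L2_set f {..<p * q :: nat}"
proof -
  have "L2_set (\<lambda>(k, i). f (k + i * q)) ({..<q} \<times> {..<p}) =
      L2_set (\<lambda>(i, k). f (k + i * q)) ({..<p} \<times> {..<q})"
    by (subst L2_set_Times_swap) simp_all
  also have "\<dots> = L2_set f {..<p * q}"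
    by (rule L2_set_div_mod)
  finally show ?thesis .
qed

text \<open>The infimum that defines the projective norm is over a nonempty set; this matters, as the
  infimum of the empty set of reals is an arbitrary number.  For \<open>u = \<Sum>i<n. a i \<otimes>\<^sub>t b i\<close> take \<open>v\<close> and
  \<open>w\<close> with \<open>i\<close>-th rows constantly \<open>a i\<close> and \<open>b i\<close>; then \<open>\<beta>\<close> selects the first column of \<open>v \<otimes> w\<close>, and \<open>\<alpha>\<close>
  sums its entries whose two row indices agree.\<close>

lemma exists_op_proj_decomposition:
  "\<exists>p q \<alpha> v w \<beta>. u = (\<Sum>r<p * q. \<Sum>s<p * q. (\<alpha> (0::nat) r * \<beta> s (0::nat)) *\<^sub>C kron_tensor q v w r s)"
proof -
  obtain n a b where u: "u = (\<Sum>i<n::nat. a i \<otimes>\<^sub>t b i)"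
    using tensor_eq_sum_elem_tensors by blast
  define \<alpha> \<beta> :: "nat \<Rightarrow> nat \<Rightarrow> complex"
    where "\<alpha> i r = (if r div n = r mod n then 1 else 0)" and "\<beta> s j = (if s = 0 then 1 else 0)" for i j r s
  define v where "v i j = a i" for i j :: nat
  define w where "w k l = b k" for k l :: nat
  have inner: "(\<Sum>s<n * n. (\<alpha> 0 r * \<beta> s 0) *\<^sub>C kron_tensor n v w r s) =
      (if r div n = r mod n then a (r div n) \<otimes>\<^sub>t b (r mod n) else 0)" if "r < n * n" for r
  proof -
    have "(\<Sum>s<n * n. (\<alpha> 0 r * \<beta> s 0) *\<^sub>C kron_tensor n v w r s) =
        (\<Sum>s<n * n. if s = 0 then \<alpha> 0 r *\<^sub>C (a (r div n) \<otimes>\<^sub>t b (r mod n)) else 0)"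
      by (intro sum.cong) (auto simp: \<beta>_def kron_tensor_def v_def w_def)
    then show ?thesis
      using that by (cases "n = 0") (simp_all add: \<alpha>_def)
  qed
  have "(\<Sum>r<n * n. \<Sum>s<n * n. (\<alpha> 0 r * \<beta> s 0) *\<^sub>C kron_tensor n v w r s) =
      (\<Sum>r<n * n. if r div n = r mod n then a (r div n) \<otimes>\<^sub>t b (r mod n) else 0)"
    by (intro sum.cong HOL.refl inner) simp
  also have "\<dots> = (\<Sum>i<n. \<Sum>k<n. if i = k then a i \<otimes>\<^sub>t b k else 0)"
    by (rule sum_div_mod[of "\<lambda>i k. if i = k then a i \<otimes>\<^sub>t b k else 0"])
  also have "\<dots> = u"
    by (simp add: u)
  finally have "u = (\<Sum>r<n * n. \<Sum>s<n * n. (\<alpha> 0 r * \<beta> s 0) *\<^sub>C kron_tensor n v w r s)" ..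
  then show ?thesis
    by - (rule exI[of _ n], rule exI[of _ n], rule exI[of _ \<alpha>], rule exI[of _ v],
        rule exI[of _ w], rule exI[of _ \<beta>])
qed

lemma le_op_proj_norm:
  assumes "\<And>p q \<alpha> v w \<beta>.
      u = (\<Sum>r<p * q. \<Sum>s<p * q. (\<alpha> 0 r * \<beta> s 0) *\<^sub>C kron_tensor q v w r s) \<Longrightarrow>
      N \<le> cmat_norm 1 (p * q) \<alpha> * rep_mat_norm \<pi> p v * rep_mat_norm \<rho> q w * cmat_norm (p * q) 1 \<beta>"
  shows "N \<le> op_proj_norm \<pi> \<rho> u"
  unfolding op_proj_norm_def
proof (rule cInf_greatest, goal_cases)
  case 1
  from exists_op_proj_decomposition[of u] obtain p q \<alpha> v w \<beta> where
    u: "u = (\<Sum>r<p * q. \<Sum>s<p * q. (\<alpha> (0::nat) r * \<beta> s (0::nat)) *\<^sub>C kron_tensor q v w r s)"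
    by (elim exE)
  show ?case
    by (rule ex_in_conv[THEN iffD1], rule exI, rule CollectI, rule exI[of _ p], rule exI[of _ q],
        rule exI[of _ \<alpha>], rule exI[of _ v], rule exI[of _ w], rule exI[of _ \<beta>],
        rule conjI, rule HOL.refl, rule u)
next
  case (2 x)
  then obtain p q \<alpha> v w \<beta> where
    x: "x = cmat_norm 1 (p * q) \<alpha> * rep_mat_norm \<pi> p v * rep_mat_norm \<rho> q w * cmat_norm (p * q) 1 \<beta>"
    and u: "u = (\<Sum>r<p * q. \<Sum>s<p * q. (\<alpha> 0 r * \<beta> s 0) *\<^sub>C kron_tensor q v w r s)"
    unfolding mem_Collect_eq by (elim exE conjE)
  show ?case unfolding x by (rule assms) (rule u)
qed

lemma clinear_kron_sum:
  assumes "clinear S"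
  shows "S (\<Sum>r<p * q. \<Sum>s<p * q. (\<alpha> 0 r * \<beta> s 0) *\<^sub>C kron_tensor q v w r s) =
    (\<Sum>i<p. \<Sum>k<q. \<Sum>j<p. \<Sum>l<q. (\<alpha> 0 (k + i * q) * \<beta> (l + j * q) 0) *\<^sub>C S (v i j \<otimes>\<^sub>t w k l))"
proof -
  have "S (\<Sum>r<p * q. \<Sum>s<p * q. (\<alpha> 0 r * \<beta> s 0) *\<^sub>C kron_tensor q v w r s) =
      (\<Sum>r<p * q. \<Sum>s<p * q. (\<alpha> 0 r * \<beta> s 0) *\<^sub>C S (kron_tensor q v w r s))"
    by (simp only: clinear_sum[OF assms] clinear_scaleC[OF assms])
  also have "\<dots> = (\<Sum>i<p. \<Sum>k<q. \<Sum>s<p * q.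
      (\<alpha> 0 (k + i * q) * \<beta> s 0) *\<^sub>C S (kron_tensor q v w (k + i * q) s))"
    by (rule sum_mult_product)
  also have "\<dots> = (\<Sum>i<p. \<Sum>k<q. \<Sum>j<p. \<Sum>l<q.
      (\<alpha> 0 (k + i * q) * \<beta> (l + j * q) 0) *\<^sub>C S (kron_tensor q v w (k + i * q) (l + j * q)))"
    by (rule sum.cong[OF HOL.refl], rule sum.cong[OF HOL.refl], rule sum_mult_product)
  also have "\<dots> = (\<Sum>i<p. \<Sum>k<q. \<Sum>j<p. \<Sum>l<q.
      (\<alpha> 0 (k + i * q) * \<beta> (l + j * q) 0) *\<^sub>C S (v i j \<otimes>\<^sub>t w k l))"
    by (intro sum.cong HOL.refl) (auto simp: kron_tensor_def)
  finally show ?thesis .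
qed

text \<open>The slice maps \<open>\<phi> \<otimes> id\<close> and \<open>id \<otimes> \<psi>\<close>.\<close>

definition left_slice :: "('a::complex_vector \<Rightarrow> complex) \<Rightarrow> ('a, 'b::complex_vector) tensor \<Rightarrow> 'b"
  where "left_slice \<phi> = tensor_lift (\<lambda>a b. \<phi> a *\<^sub>C b)"

definition right_slice :: "('b::complex_vector \<Rightarrow> complex) \<Rightarrow> ('a::complex_vector, 'b) tensor \<Rightarrow> 'a"
  where "right_slice \<psi> = tensor_lift (\<lambda>a b. \<psi> b *\<^sub>C a)"

lemma
  fixes \<phi> :: "'a::complex_vector \<Rightarrow> complex" and b :: "'b::complex_vector"
  assumes "clinear \<phi>"
  shows clinear_left_slice: "clinear (left_slice \<phi> :: ('a, 'b) tensor \<Rightarrow> 'b)"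
    and left_slice_elem_tensor: "left_slice \<phi> (a \<otimes>\<^sub>t b) = \<phi> a *\<^sub>C b"
proof -
  have lin: "clinear (\<lambda>a. \<phi> a *\<^sub>C b)" "clinear (\<lambda>b. \<phi> a *\<^sub>C b)" for a and b :: 'b
    by (rule clinearI; simp add: clinear_add[OF assms] clinear_scaleC[OF assms] scaleC_complex_def
        scaleC_add_left scaleC_add_right scaleC_scaleC mult.commute)+
  show "clinear (left_slice \<phi> :: ('a, 'b) tensor \<Rightarrow> 'b)"
    unfolding left_slice_def using lin by (rule clinear_tensor_lift)
  show "left_slice \<phi> (a \<otimes>\<^sub>t b) = \<phi> a *\<^sub>C b"
    unfolding left_slice_def using lin by (rule tensor_lift_elem_tensor)
qed

lemma
  fixes \<psi> :: "'b::complex_vector \<Rightarrow> complex" and a :: "'a::complex_vector"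
  assumes "clinear \<psi>"
  shows clinear_right_slice: "clinear (right_slice \<psi> :: ('a, 'b) tensor \<Rightarrow> 'a)"
    and right_slice_elem_tensor: "right_slice \<psi> (a \<otimes>\<^sub>t b) = \<psi> b *\<^sub>C a"
proof -
  have lin: "clinear (\<lambda>a. \<psi> b *\<^sub>C a)" "clinear (\<lambda>b. \<psi> b *\<^sub>C a)" for b and a :: 'a
    by (rule clinearI; simp add: clinear_add[OF assms] clinear_scaleC[OF assms] scaleC_complex_def
        scaleC_add_left scaleC_add_right scaleC_scaleC mult.commute)+
  show "clinear (right_slice \<psi> :: ('a, 'b) tensor \<Rightarrow> 'a)"
    unfolding right_slice_def using lin by (rule clinear_tensor_lift)
  show "right_slice \<psi> (a \<otimes>\<^sub>t b) = \<psi> b *\<^sub>C a"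
    unfolding right_slice_def using lin by (rule tensor_lift_elem_tensor)
qed

text \<open>For \<open>u = \<alpha> (v \<otimes> w) \<beta>\<close> the slice is \<open>\<alpha> (\<phi>(v) \<otimes> w) \<beta>\<close>, so the bound reduces to that of the scalar
  matrix \<open>\<phi>(v)\<close> by the norm of \<open>v\<close>.\<close>

lemma norm_left_slice_le:
  fixes \<phi> :: "'a::cstar_algebra \<Rightarrow> complex"
  assumes \<pi>: "isometric_star_rep \<pi>" and \<rho>: "isometric_star_rep \<rho>" and \<phi>: "clinear \<phi>"
    and C: "0 < C" "\<And>a. cmod (\<phi> a) \<le> C * norm a"
  shows "norm (left_slice \<phi> u) \<le> C * op_proj_norm \<pi> \<rho> u"
proof -
  have "norm (left_slice \<phi> u) / C \<le> op_proj_norm \<pi> \<rho> u"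
  proof (rule le_op_proj_norm)
    fix p q and \<alpha> \<beta> :: "nat \<Rightarrow> nat \<Rightarrow> complex" and v w
    assume u: "u = (\<Sum>r<p * q. \<Sum>s<p * q. (\<alpha> 0 r * \<beta> s 0) *\<^sub>C kron_tensor q v w r s)"
    let ?V = "rep_mat_norm \<pi> p v" and ?W = "rep_mat_norm \<rho> q w"
    let ?A = "L2_set (\<lambda>r. cmod (\<alpha> 0 r)) {..<p * q}" and ?B = "L2_set (\<lambda>s. cmod (\<beta> s 0)) {..<p * q}"
    have nonneg: "0 \<le> C * ?V"
      using C(1) by (simp add: rep_mat_norm_nonneg \<pi>)
    have "norm (left_slice \<phi> u) \<le> ?A * (C * ?V) * ?W * ?B"
    proof (rule norm_le_if_rep_le[OF \<rho>])
      show "0 \<le> ?A * (C * ?V) * ?W * ?B"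
        using C(1) by (simp add: rep_mat_norm_nonneg \<pi> \<rho>)
      fix \<theta>
      have slice: "\<rho> (left_slice \<phi> u) \<theta> = (\<Sum>i<p. \<Sum>k<q. \<Sum>j<p. \<Sum>l<q.
          (\<alpha> 0 (k + i * q) * \<beta> (l + j * q) 0 * \<phi> (v i j)) *\<^sub>C \<rho> (w k l) \<theta>)"
        by (simp add: u clinear_kron_sum[OF clinear_left_slice[OF \<phi>]] left_slice_elem_tensor[OF \<phi>]
            clinear_sum[OF isometric_star_repD(4)[OF \<rho>]]
            clinear_scaleC[OF isometric_star_repD(4)[OF \<rho>]] scaleC_scaleC)
      have "norm (\<rho> (left_slice \<phi> u) \<theta>) \<le>
          L2_set (\<lambda>(i, k). cmod (\<alpha> 0 (k + i * q))) ({..<p} \<times> {..<q}) * (C * ?V) * ?W *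
          L2_set (\<lambda>(j, l). cmod (\<beta> (l + j * q) 0)) ({..<p} \<times> {..<q}) * norm \<theta>"
        unfolding slice
      proof (rule norm_kron_sum_le[where M = "\<lambda>i j. \<phi> (v i j)" and T = "\<lambda>k l. \<rho> (w k l)"
            and \<alpha> = "\<lambda>i k. \<alpha> 0 (k + i * q)" and \<beta> = "\<lambda>j l. \<beta> (l + j * q) 0"])
        show "clinear (\<rho> (w k l))" for k l by (rule isometric_star_repD(1)[OF \<rho>])
        show "0 \<le> C * ?V" "0 \<le> ?W"
          by (rule nonneg, rule rep_mat_norm_nonneg[OF \<rho>])
        show "L2_set (\<lambda>i. cmod (\<Sum>j<p. \<phi> (v i j) * x j)) {..<p} \<le> C * ?V * L2_set (\<lambda>j. cmod (x j)) {..<p}" for x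
          using less_imp_le[OF C(1)] C(2) by (rule functional_completely_bounded[OF \<pi> \<phi>])
        show "L2_set (\<lambda>k. norm (\<Sum>l<q. \<rho> (w k l) (\<xi> l))) {..<q} \<le> ?W * L2_set (\<lambda>l. norm (\<xi> l)) {..<q}" for \<xi>
          by (rule L2_set_apply_le_rep_mat_norm[OF \<rho>])
      qed
      then show "norm (\<rho> (left_slice \<phi> u) \<theta>) \<le> ?A * (C * ?V) * ?W * ?B * norm \<theta>"
        by (simp only: L2_set_div_mod[of "\<lambda>r. cmod (\<alpha> 0 r)"] L2_set_div_mod[of "\<lambda>s. cmod (\<beta> s 0)"])
    qed
    also have "\<dots> \<le> cmat_norm 1 (p * q) \<alpha> * (C * ?V) * ?W * cmat_norm (p * q) 1 \<beta>"
      using C(1) by (intro mult_mono L2_set_row_le_cmat_norm L2_set_column_le_cmat_norm)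
        (simp_all add: rep_mat_norm_nonneg \<pi> \<rho> cmat_norm_nonneg)
    finally show "norm (left_slice \<phi> u) / C \<le>
        cmat_norm 1 (p * q) \<alpha> * ?V * ?W * cmat_norm (p * q) 1 \<beta>"
      using C(1) by (simp add: field_simps)
  qed
  then show ?thesis using C(1) by (simp add: field_simps)
qed

lemma norm_right_slice_le:
  fixes \<psi> :: "'b::cstar_algebra \<Rightarrow> complex"
  assumes \<pi>: "isometric_star_rep \<pi>" and \<rho>: "isometric_star_rep \<rho>" and \<psi>: "clinear \<psi>"
    and C: "0 < C" "\<And>b. cmod (\<psi> b) \<le> C * norm b"
  shows "norm (right_slice \<psi> u) \<le> C * op_proj_norm \<pi> \<rho> u"
proof -
  have "norm (right_slice \<psi> u) / C \<le> op_proj_norm \<pi> \<rho> u"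
  proof (rule le_op_proj_norm)
    fix p q and \<alpha> \<beta> :: "nat \<Rightarrow> nat \<Rightarrow> complex" and v w
    assume u: "u = (\<Sum>r<p * q. \<Sum>s<p * q. (\<alpha> 0 r * \<beta> s 0) *\<^sub>C kron_tensor q v w r s)"
    let ?V = "rep_mat_norm \<pi> p v" and ?W = "rep_mat_norm \<rho> q w"
    let ?A = "L2_set (\<lambda>r. cmod (\<alpha> 0 r)) {..<p * q}" and ?B = "L2_set (\<lambda>s. cmod (\<beta> s 0)) {..<p * q}"
    have nonneg: "0 \<le> C * ?W"
      using C(1) by (simp add: rep_mat_norm_nonneg \<rho>)
    have "norm (right_slice \<psi> u) \<le> ?A * (C * ?W) * ?V * ?B"
    proof (rule norm_le_if_rep_le[OF \<pi>])
      show "0 \<le> ?A * (C * ?W) * ?V * ?B"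
        using C(1) by (simp add: rep_mat_norm_nonneg \<pi> \<rho>)
      fix \<theta>
      have "\<pi> (right_slice \<psi> u) \<theta> = (\<Sum>i<p. \<Sum>k<q. \<Sum>j<p. \<Sum>l<q.
          (\<alpha> 0 (k + i * q) * \<beta> (l + j * q) 0 * \<psi> (w k l)) *\<^sub>C \<pi> (v i j) \<theta>)"
        by (simp add: u clinear_kron_sum[OF clinear_right_slice[OF \<psi>]] right_slice_elem_tensor[OF \<psi>]
            clinear_sum[OF isometric_star_repD(4)[OF \<pi>]]
            clinear_scaleC[OF isometric_star_repD(4)[OF \<pi>]] scaleC_scaleC)
      \<comment> \<open>now the scalar matrix sits in the second tensor factor, so the index pairs trade places\<close>
      also have "\<dots> = (\<Sum>k<q. \<Sum>i<p. \<Sum>l<q. \<Sum>j<p.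
          (\<alpha> 0 (k + i * q) * \<beta> (l + j * q) 0 * \<psi> (w k l)) *\<^sub>C \<pi> (v i j) \<theta>)"
        by (subst sum.swap) (intro sum.cong HOL.refl sum.swap)
      finally have slice: "\<pi> (right_slice \<psi> u) \<theta> = (\<Sum>k<q. \<Sum>i<p. \<Sum>l<q. \<Sum>j<p.
          (\<alpha> 0 (k + i * q) * \<beta> (l + j * q) 0 * \<psi> (w k l)) *\<^sub>C \<pi> (v i j) \<theta>)" .
      have "norm (\<pi> (right_slice \<psi> u) \<theta>) \<le>
          L2_set (\<lambda>(k, i). cmod (\<alpha> 0 (k + i * q))) ({..<q} \<times> {..<p}) * (C * ?W) * ?V *
          L2_set (\<lambda>(l, j). cmod (\<beta> (l + j * q) 0)) ({..<q} \<times> {..<p}) * norm \<theta>"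
        unfolding slice
      proof (rule norm_kron_sum_le[where M = "\<lambda>i j. \<psi> (w i j)" and T = "\<lambda>k l. \<pi> (v k l)"
            and \<alpha> = "\<lambda>k i. \<alpha> 0 (k + i * q)" and \<beta> = "\<lambda>l j. \<beta> (l + j * q) 0"])
        show "clinear (\<pi> (v k l))" for k l by (rule isometric_star_repD(1)[OF \<pi>])
        show "0 \<le> C * ?W" "0 \<le> ?V"
          by (rule nonneg, rule rep_mat_norm_nonneg[OF \<pi>])
        show "L2_set (\<lambda>i. cmod (\<Sum>j<q. \<psi> (w i j) * x j)) {..<q} \<le> C * ?W * L2_set (\<lambda>j. cmod (x j)) {..<q}" for x
          using less_imp_le[OF C(1)] C(2) by (rule functional_completely_bounded[OF \<rho> \<psi>])
        show "L2_set (\<lambda>k. norm (\<Sum>l<p. \<pi> (v k l) (\<xi> l))) {..<p} \<le> ?V * L2_set (\<lambda>l. norm (\<xi> l)) {..<p}" for \<xi>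
          by (rule L2_set_apply_le_rep_mat_norm[OF \<pi>])
      qed
      then show "norm (\<pi> (right_slice \<psi> u) \<theta>) \<le> ?A * (C * ?W) * ?V * ?B * norm \<theta>"
        by (simp only: L2_set_div_mod_swap[of "\<lambda>r. cmod (\<alpha> 0 r)"]
            L2_set_div_mod_swap[of "\<lambda>s. cmod (\<beta> s 0)"])
    qed
    also have "\<dots> \<le> cmat_norm 1 (p * q) \<alpha> * (C * ?W) * ?V * cmat_norm (p * q) 1 \<beta>"
      using C(1) by (intro mult_mono L2_set_row_le_cmat_norm L2_set_column_le_cmat_norm)
        (simp_all add: rep_mat_norm_nonneg \<pi> \<rho> cmat_norm_nonneg)
    finally show "norm (right_slice \<psi> u) / C \<le>
        cmat_norm 1 (p * q) \<alpha> * ?V * ?W * cmat_norm (p * q) 1 \<beta>"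
      using C(1) by (simp add: field_simps)
  qed
  then show ?thesis using C(1) by (simp add: field_simps)
qed

section \<open>Extension to the completion\<close>

lemma dense_range_induct:
  assumes dense: "closure (range \<iota>) = UNIV" and closed: "closed {x. P x}"
    and range: "\<And>u. P (\<iota> u)"
  shows "P x"
proof -
  have "closure (range \<iota>) \<subseteq> {x. P x}"
    using range by (intro closure_minimal closed) auto
  with dense show ?thesis by auto
qed

text \<open>The bound makes \<open>S\<close> constant on the fibres of \<open>\<iota>\<close>, so that it factors through \<open>\<iota>\<close> even where
  injectivity of \<open>\<iota>\<close> is unknown, and uniform continuity of the factor extends it to the closure.\<close>

lemma continuous_extension_from_dense_range:
  fixes \<iota> :: "'t::complex_vector \<Rightarrow> 'x::complex_normed_vector"
    and S :: "'t \<Rightarrow> 'c::{complex_normed_vector, banach}"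
  assumes \<iota>: "clinear \<iota>" "closure (range \<iota>) = UNIV"
    and S: "clinear S" "\<And>u. norm (S u) \<le> C * norm (\<iota> u)"
  obtains R where "continuous_on UNIV R" "\<And>u. R (\<iota> u) = S u"
proof -
  have diff: "norm (S u - S v) \<le> C * norm (\<iota> u - \<iota> v)" for u v
    using S(2)[of "u - v"] by (simp add: clinear_diff[OF S(1)] clinear_diff[OF \<iota>(1)])
  define g where "g x = S (inv \<iota> x)" for x
  have g: "g (\<iota> u) = S u" for u
    using diff[of "inv \<iota> (\<iota> u)" u] by (simp add: g_def f_inv_into_f)
  have "uniformly_continuous_on (range \<iota>) g"
    unfolding uniformly_continuous_on_def
  proof (intro allI impI)
    fix e :: real assume e: "0 < e"
    show "\<exists>d>0. \<forall>x\<in>range \<iota>. \<forall>x'\<in>range \<iota>. dist x' x < d \<longrightarrow> dist (g x') (g x) < e"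
    proof (intro exI[of _ "e / (\<bar>C\<bar> + 1)"] conjI ballI impI)
      show "0 < e / (\<bar>C\<bar> + 1)" using e by simp
      fix x x' assume "x \<in> range \<iota>" "x' \<in> range \<iota>" and d: "dist x' x < e / (\<bar>C\<bar> + 1)"
      then obtain u u' where u: "x = \<iota> u" "x' = \<iota> u'" by blast
      have "dist (g x') (g x) \<le> C * dist x' x"
        using diff[of u' u] by (simp add: u g dist_norm)
      also have "\<dots> \<le> (\<bar>C\<bar> + 1) * dist x' x"
        by (intro mult_right_mono) auto
      also have "\<dots> < e" using d by (simp add: field_simps)
      finally show "dist (g x') (g x) < e" .
    qed
  qed
  from uniformly_continuous_on_extension_on_closure[OF this]
  obtain R where R: "uniformly_continuous_on (closure (range \<iota>)) R" "\<And>x. x \<in> range \<iota> \<Longrightarrow> g x = R x"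
    by metis
  show ?thesis
  proof
    show "continuous_on UNIV R"
      using uniformly_continuous_imp_continuous[OF R(1)] by (simp add: \<iota>(2))
    show "R (\<iota> u) = S u" for u
      using R(2)[of "\<iota> u"] by (simp add: g)
  qed
qed

text \<open>The map \<open>t\<close> is a section of the slice map \<open>S\<close> for which \<open>S\<close> is a bimodule map: \<open>t c = e \<otimes>\<^sub>t c\<close> for
  the slice by a functional that is invariant under multiplication by \<open>e\<close>.  Applying the extension \<open>R\<close>
  of \<open>S\<close> to \<open>\<iota> (t c) * E - \<iota> (t c)\<close>, which lies in the ideal killed by \<open>R\<close>, shows \<open>c * R E = c\<close>, and
  likewise on the other side.\<close>

lemma unital_if_modular_closure:
  fixes \<iota> :: "'t::complex_vector \<Rightarrow> 'x::complex_banach_algebra"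
    and S :: "'t \<Rightarrow> 'c::complex_banach_algebra"
  assumes \<iota>: "clinear \<iota>" "closure (range \<iota>) = UNIV"
    and S: "clinear S" "\<And>u. norm (S u) \<le> C * norm (\<iota> u)"
    and K: "modular_ideal (closure (\<iota> ` N))" "\<And>u. u \<in> N \<Longrightarrow> S u = 0"
    and t: "\<And>c. S (t c) = c"
    and left: "\<And>c u. \<exists>u'. \<iota> (t c) * \<iota> u = \<iota> u' \<and> S u' = c * S u"
    and right: "\<And>c u. \<exists>u'. \<iota> u * \<iota> (t c) = \<iota> u' \<and> S u' = S u * c"
  shows "is_unital TYPE('c)"
proof -
  obtain R where cont: "continuous_on UNIV R" and R: "\<And>u. R (\<iota> u) = S u"
    using continuous_extension_from_dense_range[OF \<iota> S] by metis
  have cont': "continuous_on UNIV (\<lambda>x. R (h x))" if "continuous_on UNIV h" for h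
    using continuous_on_compose2[OF cont that] by simp
  have "closure (\<iota> ` N) \<subseteq> {x. R x = 0}"
    using K(2) by (intro closure_minimal closed_Collect_eq cont continuous_on_const) (auto simp: R)
  then have zero: "R x = 0" if "x \<in> closure (\<iota> ` N)" for x
    using that by blast
  \<comment> \<open>not linearity of \<open>R\<close> but density of the range of \<open>\<iota>\<close> gives the next two identities\<close>
  have l: "R (\<iota> (t c) * x - \<iota> (t c)) = c * R x - c" for c x
  proof (rule dense_range_induct[OF \<iota>(2), where x = x])
    show "closed {x. R (\<iota> (t c) * x - \<iota> (t c)) = c * R x - c}"
      by (intro closed_Collect_eq cont' continuous_intros cont)
    fix u
    obtain u' where u': "\<iota> (t c) * \<iota> u = \<iota> u'" "S u' = c * S u"
      using left by blast
    then show "R (\<iota> (t c) * \<iota> u - \<iota> (t c)) = c * R (\<iota> u) - c"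
      by (simp add: R clinear_diff[OF S(1)] t flip: clinear_diff[OF \<iota>(1)])
  qed
  have r: "R (x * \<iota> (t c) - \<iota> (t c)) = R x * c - c" for c x
  proof (rule dense_range_induct[OF \<iota>(2), where x = x])
    show "closed {x. R (x * \<iota> (t c) - \<iota> (t c)) = R x * c - c}"
      by (intro closed_Collect_eq cont' continuous_intros cont)
    fix u
    obtain u' where u': "\<iota> u * \<iota> (t c) = \<iota> u'" "S u' = S u * c"
      using right by blast
    then show "R (\<iota> u * \<iota> (t c) - \<iota> (t c)) = R (\<iota> u) * c - c"
      by (simp add: R clinear_diff[OF S(1)] t flip: clinear_diff[OF \<iota>(1)])
  qed
  from K(1) obtain E where E: "\<And>x. x * E - x \<in> closure (\<iota> ` N)" "\<And>x. E * x - x \<in> closure (\<iota> ` N)"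
    by (auto simp: modular_ideal_def)
  have "R E * c = c \<and> c * R E = c" for c
    using zero[OF E(1)[of "\<iota> (t c)"]] zero[OF E(2)[of "\<iota> (t c)"]] by (simp add: l r)
  then show ?thesis by (auto simp: is_unital_def)
qed

lemma clinear_vanishes_on_subspace_tensor:
  assumes "clinear S" "\<And>a b. a \<in> E \<Longrightarrow> b \<in> F \<Longrightarrow> S (a \<otimes>\<^sub>t b) = 0" "u \<in> subspace_tensor E F"
  shows "S u = 0"
  using assms(3) unfolding subspace_tensor_def
proof (induction rule: complex_vector.span_induct_alt)
  case base
  show ?case by (rule clinear_zero[OF assms(1)])
next
  case (step c x y)
  then show ?case
    using assms(2) by (auto simp: clinear_add[OF assms(1)] clinear_scaleC[OF assms(1)]
        complex_vector.scale_zero_right)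
qed

section \<open>The closed ideal spanned by two ideals\<close>

lemma is_op_proj_tensorD:
  assumes "is_op_proj_tensor \<pi> \<rho> \<iota>"
  shows "clinear \<iota>" "norm (\<iota> u) = op_proj_norm \<pi> \<rho> u" "closure (range \<iota>) = UNIV"
    "\<iota> (a \<otimes>\<^sub>t b) * \<iota> (c \<otimes>\<^sub>t d) = \<iota> ((a * c) \<otimes>\<^sub>t (b * d))"
  using assms by (auto simp: is_op_proj_tensor_def)

lemma complex_subspace_closure:
  fixes S :: "'a::complex_normed_vector set"
  assumes "complex_vector.subspace S"
  shows "complex_vector.subspace (closure S)"
proof -
  have "x + y \<in> closure S" if "x \<in> closure S" "y \<in> closure S" for x y
  proof -
    from that obtain f g where "\<And>n. f n \<in> S" "f \<longlonglongrightarrow> x" "\<And>n. g n \<in> S" "g \<longlonglongrightarrow> y"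
      unfolding closure_sequential by blast
    then have "\<forall>n. f n + g n \<in> S" "(\<lambda>n. f n + g n) \<longlonglongrightarrow> x + y"
      using assms by (auto intro: complex_vector.subspace_add tendsto_add)
    then show ?thesis
      unfolding closure_sequential by (intro exI[of _ "\<lambda>n. f n + g n"]) simp
  qed
  moreover have "0 \<in> closure S"
    using complex_vector.subspace_0[OF assms] closure_subset by blast
  moreover have "c *\<^sub>C x \<in> closure S" if "x \<in> closure S" for c x
  proof -
    have "(\<lambda>x. c *\<^sub>C x) ` closure S \<subseteq> closure ((\<lambda>x. c *\<^sub>C x) ` S)"
      by (rule closure_bounded_linear_image_subset) (rule bounded_linear_scaleC)
    also have "\<dots> \<subseteq> closure S"
      using assms by (intro closure_mono) (auto intro: complex_vector.subspace_scale)
    finally show ?thesis using that by blast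
  qed
  ultimately show ?thesis
    by (simp add: complex_vector.subspace_def)
qed

text \<open>Products of elementary tensors stay in the span by the ideal property of \<open>I\<close> and \<open>J\<close>; joint
  limits, first in the ideal and then in the ambient algebra, follow from continuity of the
  multiplication by a fixed element.\<close>

lemma two_sided_ideal_closure_subspace_tensor:
  fixes \<iota> :: "('a::cstar_algebra, 'b::cstar_algebra) tensor \<Rightarrow> 'x::complex_banach_algebra"
  assumes \<iota>: "is_op_proj_tensor \<pi> \<rho> \<iota>" and I: "two_sided_ideal I" and J: "two_sided_ideal J"
  shows "two_sided_ideal (closure (\<iota> ` subspace_tensor I J))"
proof -
  note lin = is_op_proj_tensorD(1)[OF \<iota>]
  let ?N = "\<iota> ` subspace_tensor I J"
  interpret \<iota>: module_hom scaleC scaleC \<iota> by (rule clinear_module_hom[OF lin])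
  have sub: "complex_vector.subspace ?N"
    unfolding subspace_tensor_def by (intro \<iota>.subspace_image complex_vector.subspace_span)
  have sub_cl: "complex_vector.subspace (closure ?N)"
    by (rule complex_subspace_closure[OF sub])
  have elem: "\<iota> (a \<otimes>\<^sub>t b) \<in> ?N" if "a \<in> I" "b \<in> J" for a b
    using that unfolding subspace_tensor_def by (intro imageI complex_vector.span_base) auto
  have mult_elem: "\<iota> u * \<iota> (a \<otimes>\<^sub>t b) \<in> ?N \<and> \<iota> (a \<otimes>\<^sub>t b) * \<iota> u \<in> ?N" if "a \<in> I" "b \<in> J" for a b u
  proof (induction u rule: tensor_induct)
    case zero
    show ?case using complex_vector.subspace_0[OF sub] by (simp add: clinear_zero[OF lin])
  next
    case (add c d u)
    have "\<iota> (c \<otimes>\<^sub>t d) * \<iota> (a \<otimes>\<^sub>t b) \<in> ?N" "\<iota> (a \<otimes>\<^sub>t b) * \<iota> (c \<otimes>\<^sub>t d) \<in> ?N"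
      unfolding is_op_proj_tensorD(4)[OF \<iota>] using I J that
      by (auto intro!: elem simp: two_sided_ideal_def)
    with add show ?case
      by (auto simp: clinear_add[OF lin] distrib_left distrib_right intro: complex_vector.subspace_add[OF sub])
  qed
  have mult_N: "\<iota> u * \<iota> n \<in> ?N \<and> \<iota> n * \<iota> u \<in> ?N" if "n \<in> subspace_tensor I J" for u n
    using that unfolding subspace_tensor_def[of I J]
  proof (induction rule: complex_vector.span_induct_alt)
    case base
    show ?case using complex_vector.subspace_0[OF sub]
      by (simp add: clinear_zero[OF lin] subspace_tensor_def)
  next
    case (step c x y)
    then have "\<iota> u * \<iota> x \<in> ?N \<and> \<iota> x * \<iota> u \<in> ?N" using mult_elem by blast
    with step show ?case
      unfolding subspace_tensor_def[of I J, symmetric]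
      by (auto simp: clinear_add[OF lin] clinear_scaleC[OF lin] distrib_left distrib_right
          mult_scaleC_left mult_scaleC_right
          intro!: complex_vector.subspace_add[OF sub] complex_vector.subspace_scale[OF sub])
  qed
  have mult: "\<iota> u * x \<in> closure ?N \<and> x * \<iota> u \<in> closure ?N" if "x \<in> closure ?N" for u x
  proof -
    have "(\<lambda>x. \<iota> u * x) ` closure ?N \<subseteq> closure ((\<lambda>x. \<iota> u * x) ` ?N)"
      "(\<lambda>x. x * \<iota> u) ` closure ?N \<subseteq> closure ((\<lambda>x. x * \<iota> u) ` ?N)"
      by (rule closure_bounded_linear_image_subset;
          rule bounded_linear_mult_right bounded_linear_mult_left)+
    moreover have "closure ((\<lambda>x. \<iota> u * x) ` ?N) \<subseteq> closure ?N" "closure ((\<lambda>x. x * \<iota> u) ` ?N) \<subseteq> closure ?N"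
      using mult_N by (auto intro!: closure_mono)
    ultimately show ?thesis using that by blast
  qed
  have "a * x \<in> closure ?N \<and> x * a \<in> closure ?N" if x: "x \<in> closure ?N" for a x
  proof (rule dense_range_induct[OF is_op_proj_tensorD(3)[OF \<iota>], where x = a])
    have "closed ((\<lambda>a. a * x) -` closure ?N)" "closed ((\<lambda>a. x * a) -` closure ?N)"
      by (intro closed_vimage closed_closure continuous_intros)+
    then have "closed (((\<lambda>a. a * x) -` closure ?N) \<inter> ((\<lambda>a. x * a) -` closure ?N))"
      by (rule closed_Int)
    then show "closed {a. a * x \<in> closure ?N \<and> x * a \<in> closure ?N}"
      by (simp add: vimage_def Collect_conj_eq)
  qed (rule mult[OF x])
  with sub_cl show ?thesis by (auto simp: two_sided_ideal_def)
qed

lemma op_proj_tensor_unit: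
  assumes \<iota>: "is_op_proj_tensor \<pi> \<rho> \<iota>"
    and e: "\<And>a. e * a = a \<and> a * e = a" and f: "\<And>b. f * b = b \<and> b * f = b"
  shows "\<iota> (e \<otimes>\<^sub>t f) * x = x \<and> x * \<iota> (e \<otimes>\<^sub>t f) = x"
proof (rule dense_range_induct[OF is_op_proj_tensorD(3)[OF \<iota>], where x = x])
  show "closed {x. \<iota> (e \<otimes>\<^sub>t f) * x = x \<and> x * \<iota> (e \<otimes>\<^sub>t f) = x}"
    by (intro closed_Collect_conj closed_Collect_eq continuous_intros)
  show "\<iota> (e \<otimes>\<^sub>t f) * \<iota> u = \<iota> u \<and> \<iota> u * \<iota> (e \<otimes>\<^sub>t f) = \<iota> u" for u
    by (induction u rule: tensor_induct)
      (simp_all add: clinear_zero clinear_add is_op_proj_tensorD[OF \<iota>] distrib_left distrib_right e f)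
qed

section \<open>Modularity of the tensor product of two modular ideals\<close>

theorem theorem3p3:
  fixes \<pi> :: "'a::cstar_algebra \<Rightarrow> 'h::chilbert_space \<Rightarrow> 'h"
    and \<rho> :: "'b::cstar_algebra \<Rightarrow> 'k::chilbert_space \<Rightarrow> 'k"
    and \<iota> :: "('a, 'b) tensor \<Rightarrow> 'x::complex_banach_algebra"
    and I :: "'a set" and J :: "'b set"
  assumes "isometric_star_rep \<pi>" and "isometric_star_rep \<rho>"
    and "is_op_proj_tensor \<pi> \<rho> \<iota>"
    and "closed I" and "modular_ideal I" and "I \<noteq> UNIV"
    and "closed J" and "modular_ideal J" and "J \<noteq> UNIV"
  shows "modular_ideal (closure (\<iota> ` subspace_tensor I J)) \<longleftrightarrow>
         is_unital TYPE('a) \<and> is_unital TYPE('b)"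
proof
  note \<iota> = is_op_proj_tensorD[OF assms(3)]
  assume K: "modular_ideal (closure (\<iota> ` subspace_tensor I J))"
  have "is_unital TYPE('b)"
  proof -
    from modular_ideal_functional[OF assms(4-6)] obtain \<phi> C e where
      \<phi>: "clinear \<phi>" "0 < C" "\<And>x. cmod (\<phi> x) \<le> C * norm x" "\<And>x. x \<in> I \<Longrightarrow> \<phi> x = 0"
      and e: "\<phi> e = 1" "\<And>x. \<phi> (e * x) = \<phi> x" "\<And>x. \<phi> (x * e) = \<phi> x" by metis
    note S = clinear_left_slice[OF \<phi>(1), where 'b = 'b]
    note slice = left_slice_elem_tensor[OF \<phi>(1), where 'b = 'b]
    show ?thesis
    proof (rule unital_if_modular_closure[OF \<iota>(1,3) S _ K])
      show "norm (left_slice \<phi> u) \<le> C * norm (\<iota> u)" for u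
        unfolding \<iota>(2) by (rule norm_left_slice_le[OF assms(1,2) \<phi>(1-3)])
      show "left_slice \<phi> u = 0" if "u \<in> subspace_tensor I J" for u
        by (rule clinear_vanishes_on_subspace_tensor[OF S _ that]) (simp add: slice \<phi>(4))
      show "left_slice \<phi> (e \<otimes>\<^sub>t b) = b" for b :: 'b
        by (simp add: slice e)
      show "\<exists>u'. \<iota> (e \<otimes>\<^sub>t b) * \<iota> u = \<iota> u' \<and> left_slice \<phi> u' = b * left_slice \<phi> u" for b u
      proof (induction u rule: tensor_induct)
        case zero
        show ?case by (rule exI[of _ 0]) (simp add: clinear_zero[OF \<iota>(1)] clinear_zero[OF S])
      next
        case (add c d u)
        then obtain u' where "\<iota> (e \<otimes>\<^sub>t b) * \<iota> u = \<iota> u'" "left_slice \<phi> u' = b * left_slice \<phi> u" by blast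
        then show ?case
          by (intro exI[of _ "u' + (e * c) \<otimes>\<^sub>t (b * d)"])
            (simp add: clinear_add[OF \<iota>(1)] clinear_add[OF S] \<iota>(4) slice e distrib_left mult_scaleC_right)
      qed
      show "\<exists>u'. \<iota> u * \<iota> (e \<otimes>\<^sub>t b) = \<iota> u' \<and> left_slice \<phi> u' = left_slice \<phi> u * b" for b u
      proof (induction u rule: tensor_induct)
        case zero
        show ?case by (rule exI[of _ 0]) (simp add: clinear_zero[OF \<iota>(1)] clinear_zero[OF S])
      next
        case (add c d u)
        then obtain u' where "\<iota> u * \<iota> (e \<otimes>\<^sub>t b) = \<iota> u'" "left_slice \<phi> u' = left_slice \<phi> u * b" by blast
        then show ?case
          by (intro exI[of _ "u' + (c * e) \<otimes>\<^sub>t (d * b)"])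
            (simp add: clinear_add[OF \<iota>(1)] clinear_add[OF S] \<iota>(4) slice e distrib_right mult_scaleC_left)
      qed
    qed
  qed
  moreover have "is_unital TYPE('a)"
  proof -
    from modular_ideal_functional[OF assms(7-9)] obtain \<psi> C f where
      \<psi>: "clinear \<psi>" "0 < C" "\<And>x. cmod (\<psi> x) \<le> C * norm x" "\<And>x. x \<in> J \<Longrightarrow> \<psi> x = 0"
      and f: "\<psi> f = 1" "\<And>x. \<psi> (f * x) = \<psi> x" "\<And>x. \<psi> (x * f) = \<psi> x" by metis
    note S = clinear_right_slice[OF \<psi>(1), where 'a = 'a]
    note slice = right_slice_elem_tensor[OF \<psi>(1), where 'a = 'a]
    show ?thesis
    proof (rule unital_if_modular_closure[where t = "\<lambda>a. a \<otimes>\<^sub>t f", OF \<iota>(1,3) S _ K])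
      show "norm (right_slice \<psi> u) \<le> C * norm (\<iota> u)" for u
        unfolding \<iota>(2) by (rule norm_right_slice_le[OF assms(1,2) \<psi>(1-3)])
      show "right_slice \<psi> u = 0" if "u \<in> subspace_tensor I J" for u
        by (rule clinear_vanishes_on_subspace_tensor[OF S _ that]) (simp add: slice \<psi>(4))
      show "right_slice \<psi> (a \<otimes>\<^sub>t f) = a" for a :: 'a
        by (simp add: slice f)
      show "\<exists>u'. \<iota> (a \<otimes>\<^sub>t f) * \<iota> u = \<iota> u' \<and> right_slice \<psi> u' = a * right_slice \<psi> u" for a u
      proof (induction u rule: tensor_induct)
        case zero
        show ?case by (rule exI[of _ 0]) (simp add: clinear_zero[OF \<iota>(1)] clinear_zero[OF S])
      next
        case (add c d u)
        then obtain u' where "\<iota> (a \<otimes>\<^sub>t f) * \<iota> u = \<iota> u'" "right_slice \<psi> u' = a * right_slice \<psi> u" by blast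
        then show ?case
          by (intro exI[of _ "u' + (a * c) \<otimes>\<^sub>t (f * d)"])
            (simp add: clinear_add[OF \<iota>(1)] clinear_add[OF S] \<iota>(4) slice f distrib_left mult_scaleC_right)
      qed
      show "\<exists>u'. \<iota> u * \<iota> (a \<otimes>\<^sub>t f) = \<iota> u' \<and> right_slice \<psi> u' = right_slice \<psi> u * a" for a u
      proof (induction u rule: tensor_induct)
        case zero
        show ?case by (rule exI[of _ 0]) (simp add: clinear_zero[OF \<iota>(1)] clinear_zero[OF S])
      next
        case (add c d u)
        then obtain u' where "\<iota> u * \<iota> (a \<otimes>\<^sub>t f) = \<iota> u'" "right_slice \<psi> u' = right_slice \<psi> u * a" by blast
        then show ?case
          by (intro exI[of _ "u' + (c * a) \<otimes>\<^sub>t (d * f)"])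
            (simp add: clinear_add[OF \<iota>(1)] clinear_add[OF S] \<iota>(4) slice f distrib_right mult_scaleC_left)
      qed
    qed
  qed
  ultimately show "is_unital TYPE('a) \<and> is_unital TYPE('b)" by blast
next
  assume "is_unital TYPE('a) \<and> is_unital TYPE('b)"
  then obtain e :: 'a and f :: 'b where "\<And>a. e * a = a \<and> a * e = a" "\<And>b. f * b = b \<and> b * f = b"
    by (auto simp: is_unital_def)
  note unit = op_proj_tensor_unit[OF assms(3) this]
  have ideal: "two_sided_ideal (closure (\<iota> ` subspace_tensor I J))"
    using assms(5,8) by (intro two_sided_ideal_closure_subspace_tensor[OF assms(3)])
      (simp_all add: modular_ideal_def)
  then have "0 \<in> closure (\<iota> ` subspace_tensor I J)"
    by (simp add: two_sided_ideal_def complex_vector.subspace_0)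
  with ideal unit show "modular_ideal (closure (\<iota> ` subspace_tensor I J))"
    unfolding modular_ideal_def by (metis diff_self)
qed

end
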